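(* For all $b_1,b_2,b_3\in\mathbf B$, the structure constant $C_{b_1,b_2}^{b_3}\in\mathbb C[q^{\pm1/4},t^{\pm1/4}]$ of the associative multiplication of $\mathcal A_{q,t}$ in the basis $\mathbf B$ specializes to (i) the corresponding structure constant of the commutative multiplication in $\mathcal A_{q=1,t}$ as $q^{1/4}\to1$; (ii) the corresponding structure constant of the commutative multiplication in $\mathcal A_{q=t=1}$ as $q^{1/4},t^{1/4}\to1$. Here the structure constants of the commutative algebras are taken in their monomial bases consisting of the commutative counterparts of the elements of $\mathbf B$.
   Context: Algebra $\mathcal A_{q,t}$. Let $\mathbf k=\mathbb C(q^{1/4},t^{1/4})$ and $[A,B]_{q^j}=\dfrac{q^{j/4}AB-q^{-j/4}BA}{q^{1/2}-q^{-1/2}}$ for $j\in\mathbb Z$ (with $[A,B]_q=[A,B]_{q^1}$). $\mathcal A_{q,t}$ is the associative unital $\mathbf k$-algebra with 15 generators $O_1,\dots,O_6$, $O_{12},O_{23},O_{34},O_{45},O_{56},O_{61}$, $O_{123},O_{234},O_{345}$. Indices are read cyclically modulo 6 with values in $\{1,\dots,6\}$, and $O_{456}:=O_{123}$, $O_{561}:=O_{234}$, $O_{612}:=O_{345}$. Put $\theta=(q+t)q^{-1/2}t^{-1/2}$. The defining relations are, for all $i$ modulo 6: (R1) $[O_i,O_{i+1}]_q=O_{i,i+1}$; $O_iO_j=O_jO_i$ if $i-j\not\equiv0,\pm1$ mod 6. (R2) $[O_{i,i+1},O_i]_q=O_{i+1}$; $[O_{i+1},O_{i,i+1}]_q=O_i$;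 $[O_{i,i+1},O_{i+2}]_q=O_{i,i+1,i+2}$; $[O_{i-1},O_{i,i+1}]_q=O_{i-1,i,i+1}$; $O_{i,i+1}$ commutes with $O_{i+3}$ and $O_{i+4}$. (R3) $[O_{i,i+1,i+2},O_i]_q=O_{i+1,i+2}$; $[O_{i+2},O_{i,i+1,i+2}]_q=O_{i,i+1}$; $O_{i,i+1,i+2}$ commutes with $O_{i+1}$. (R4) $[O_{i+1,i+2},O_{i,i+1}]_{q^2}=q^{-1/2}(q+1)O_iO_{i+2}-\theta O_{i+4}$; $[O_{i,i+1},O_{i+2,i+3}]_q=O_{i+4,i+5}$; $O_{i,i+1}$ commutes with $O_{i+3,i+4}$. (R5) $[O_{i,i+1,i+2},O_{i,i+1}]_q=O_{i+2}$; $[O_{i+1,i+2},O_{i,i+1,i+2}]_q=O_i$; $[O_{i,i+1,i+2},O_{i+2,i+3}]_{q^0}=O_{i+2}O_{i+4,i+5}-O_{i+3}O_{i,i+1}$. (R6) $[O_{123},O_{345}]_{q^2}=-\theta O_1O_5O_6+\theta q^{-1/4}O_5O_{61}+\theta q^{1/4}O_1O_{56}-\theta O_{234}+q^{-1/2}(q+1)O_3O_6$; $[O_{234},O_{123}]_{q^2}=-\theta O_2O_6O_1+\theta q^{-1/4}O_6O_{12}+\theta q^{1/4}O_2O_{61}-\theta O_{345}+q^{-1/2}(q+1)O_4O_1$; $[O_{345},O_{234}]_{q^2}=-\theta O_3O_1O_2+\theta q^{-1/4}O_1O_{23}+\theta q^{1/4}O_3O_{12}-\theta O_{123}+q^{-1/2}(q+1)O_5O_2$.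 (R7, $q$-Casimir) $\frac13(O_{123}O_{234}O_{345}+O_{234}O_{345}O_{123}+O_{345}O_{123}O_{234})-\frac16q^{-1/2}(q^2+2)(O_1O_4O_{345}+O_2O_5O_{123}+O_3O_6O_{234}+O_4O_1O_{345}+O_5O_2O_{123}+O_6O_3O_{234})+\frac16q^{-5/4}t^{-1/2}(2q+1)(q+t)(O_1O_6O_{61}+O_2O_1O_{12}+O_3O_2O_{23}+O_4O_3O_{34}+O_5O_4O_{45}+O_6O_5O_{56})-\frac13q^{1/2}(O_1O_3O_5+O_2O_4O_6+O_3O_5O_1+O_4O_6O_2+O_5O_1O_3+O_6O_2O_4)-\frac16q^{-3/2}t^{-1/2}(2q+1)(q+t)(O_{12}^2+O_{23}^2+O_{34}^2+O_{45}^2+O_{56}^2+O_{61}^2)+\frac16q^{-3/2}t^{-1/2}(q-1)(q+t)(O_1^2+\dots+O_6^2)+q^{-3/2}t^{-3/2}(t+1)(q+t)(q^2+t)=0$. Algebra $\mathcal A_{q=1,t}$: the commutative algebra over $\mathbb C(t^{1/4})$ with the same 15 generators and relations, where $\kappa=t^{1/2}+t^{-1/2}$ ($1\le i\le6$): (a) $O_{i+2}O_{i+4}+O_{i+3}O_{i+2,i+3,i+4}-O_{i+2,i+3}O_{i+3,i+4}-\kappa O_i=0$; (b) $-O_{i+3}O_{i+5,i}-O_{i+4}O_{i+1,i+2}+O_{i+3,i+4}O_{i+1,i+2,i+3}-\kappa(O_{i,i+1}-O_iO_{i+1})=0$; (c) $-O_{i+1,i+2}O_{i+4,i+5}+O_{i,i+1,i+2}O_{i+1,i+2,i+3}-O_iO_{i+3}-\kappa(-O_{i+2,i+3,i+4}+O_{i+1}O_{i+5,i}+O_{i+5}O_{i,i+1}-O_iO_{i+1}O_{i+5})=0$;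 (d) $O_{123}O_{234}O_{345}-(O_1O_4O_{345}+O_2O_5O_{123}+O_3O_6O_{234})+\frac\kappa2(O_1O_6O_{61}+O_2O_1O_{12}+O_3O_2O_{23}+O_4O_3O_{34}+O_5O_4O_{45}+O_6O_5O_{56})-(O_1O_3O_5+O_2O_4O_6)-\frac\kappa2(O_{12}^2+O_{23}^2+O_{34}^2+O_{45}^2+O_{56}^2+O_{61}^2)+\kappa^3=0$. $\mathcal A_{q=t=1}$ is the commutative $\mathbb C$-algebra with the same generators and relations (a)-(d) with $t=1$, i.e. $\kappa=2$. Basis $\mathbf B$. A normally ordered monomial is $O_1^{n_1}\cdots O_6^{n_6}O_{12}^{n_7}O_{23}^{n_8}O_{34}^{n_9}O_{45}^{n_{10}}O_{56}^{n_{11}}O_{61}^{n_{12}}O_{123}^{n_{13}}O_{234}^{n_{14}}O_{345}^{n_{15}}$; its commutative counterpart is the same monomial in commuting variables. $\mathbf B$ is the set of those whose commutative counterpart is not divisible by any of: $O_{56}O_{61}$, $O_{12}O_{61}$, $O_{45}O_{56}$, $O_{34}O_{45}$, $O_{23}O_{34}$, $O_{12}O_{23}$, $O_3O_4O_5$, $O_2O_3O_4$, $O_1O_2O_3$, $O_{56}O_{345}$, $O_{23}O_{345}$, $O_{45}O_{234}$, $O_{12}O_{234}$, $O_{61}O_{123}$, $O_{34}O_{123}$, $O_3O_4O_{34}$, $O_2O_3O_{23}$, $O_1O_2O_{12}$, $O_{234}O_{345}$, $O_{123}O_{345}$, $O_{123}O_{234}$, $O_4O_5O_6^2$, $O_1O_2O_6^2$,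 $O_1O_5^2O_6$, $O_4^2O_5O_6$, $O_1O_4O_5O_6$, $O_1O_2O_5O_6$, $O_1^2O_5O_6$, $O_1O_2^2O_6$, $O_1O_5O_6O_{61}$, $O_1O_2O_6O_{61}$, $O_4O_5O_6O_{56}$, $O_1O_5O_6O_{56}$, $O_4O_5O_6O_{45}$, $O_1O_2O_6O_{45}$, $O_5O_6^2O_{34}$, $O_1O_5O_6O_{34}$, $O_1O_2O_6O_{34}$, $O_1^2O_2O_{34}$, $O_1O_6^2O_{23}$, $O_4O_5O_6O_{23}$, $O_1O_5O_6O_{23}$, $O_4O_5^2O_{23}$, $O_5^2O_6O_{12}$, $O_4O_5O_6O_{12}$, $O_3O_4^2O_{12}$, $O_1O_2O_6O_{345}$, $O_1O_5O_6O_{234}$, $O_4O_5O_6O_{123}$, $O_1O_6O_{45}O_{61}$, $O_4O_5O_{45}O_{61}$, $O_2O_3O_{45}O_{61}$, $O_1O_6O_{23}O_{61}$, $O_4O_5O_{23}O_{61}$, $O_5O_6O_{34}O_{56}$, $O_1O_2O_{34}O_{56}$, $O_5O_6O_{12}O_{56}$, $O_3O_4O_{12}O_{56}$, $O_1O_6O_{23}O_{45}$, $O_4O_5O_{23}O_{45}$, $O_5O_6O_{12}O_{34}$. $\mathbf B$ is a $\mathbf k$-basis of $\mathcal A_{q,t}$, with $b_1b_2=\sum_{b_3\in\mathbf B}C_{b_1,b_2}^{b_3}b_3$ and $C_{b_1,b_2}^{b_3}\in\mathbb C[q^{\pm1/4},t^{\pm1/4}]$; the commutative counterparts of the elements of $\mathbf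 B$ form bases of $\mathcal A_{q=1,t}$ and $\mathcal A_{q=t=1}$. *)

theory Defs
  imports
    "HOL-Library.Poly_Mapping"
    "HOL-Library.Multiset"
    "HOL-Computational_Algebra.Fraction_Field"
    "HOL-Computational_Algebra.Polynomial"
begin

section \<open>Coefficient fields and Laurent polynomials\<close>

text \<open>
  The field \<open>\<complex>(q\<^sup>1\<^sup>/\<^sup>4, t\<^sup>1\<^sup>/\<^sup>4)\<close> is the fraction field of \<open>\<complex>[t\<^sup>1\<^sup>/\<^sup>4][q\<^sup>1\<^sup>/\<^sup>4]\<close>:
  the outer polynomial variable is \<open>q\<^sup>1\<^sup>/\<^sup>4\<close>, the inner one is \<open>t\<^sup>1\<^sup>/\<^sup>4\<close>.
\<close>

type_synonym kqt = "complex poly poly fract"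
type_synonym kt = "complex poly fract"

definition q4 :: kqt where "q4 = Fraction_Field.Fract [:0, 1:] 1"
definition t4 :: kqt where "t4 = Fraction_Field.Fract [:[:0, 1:]:] 1"
definition const_kqt :: "complex \<Rightarrow> kqt" where "const_kqt c = Fraction_Field.Fract [:[:c:]:] 1"

definition s4 :: kt where "s4 = Fraction_Field.Fract [:0, 1:] 1" (* t^(1/4) in C(t^(1/4)) *)
definition const_kt :: "complex \<Rightarrow> kt" where "const_kt c = Fraction_Field.Fract [:c:] 1"

text \<open>
  An element of \<open>\<complex>[x\<^sup>\<plusminus>\<^sup>1, y\<^sup>\<plusminus>\<^sup>1]\<close> is given by its coefficients, indexed by the exponents of
  \<open>x\<close> and \<open>y\<close>. It is evaluated at nonzero points of a field \<open>'f\<close> via an embedding of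
  \<open>\<complex>\<close> into \<open>'f\<close>.
\<close>

type_synonym laurent = "(int \<times> int) \<Rightarrow>\<^sub>0 complex"

definition laurent_eval :: "(complex \<Rightarrow> 'f::field) \<Rightarrow> 'f \<Rightarrow> 'f \<Rightarrow> laurent \<Rightarrow> 'f" where
  "laurent_eval emb x y P =
    (\<Sum>(i, j) \<in> Poly_Mapping.keys P. emb (Poly_Mapping.lookup P (i, j)) * x powi i * y powi j)"


section \<open>Generators\<close>

datatype gen = O1 | O2 | O3 | O4 | O5 | O6
  | O12 | O23 | O34 | O45 | O56 | O61
  | O123 | O234 | O345

text \<open>
  For \<open>i \<ge> 0\<close>, the generators \<open>O\<^sub>i\<close>, \<open>O\<^sub>i\<^sub>,\<^sub>i\<^sub>+\<^sub>1\<close>, \<open>O\<^sub>i\<^sub>,\<^sub>i\<^sub>+\<^sub>1\<^sub>,\<^sub>i\<^sub>+\<^sub>2\<close> with indices read modulo 6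
  (index 0 stands for 6). The last one depends only on \<open>i\<close> modulo 3.
\<close>

definition single_gen :: "nat \<Rightarrow> gen" where
  "single_gen i = [O6, O1, O2, O3, O4, O5] ! (i mod 6)"
definition double_gen :: "nat \<Rightarrow> gen" where
  "double_gen i = [O61, O12, O23, O34, O45, O56] ! (i mod 6)"
definition triple_gen :: "nat \<Rightarrow> gen" where
  "triple_gen i = [O345, O123, O234] ! (i mod 3)"


section \<open>Free algebras and ideals\<close>

datatype gen_word = Word (letters: "gen list")

instantiation gen_word :: monoid_add
begin

definition zero_gen_word :: gen_word where "0 = Word []"
definition plus_gen_word :: "gen_word \<Rightarrow> gen_word \<Rightarrow> gen_word" where
  "u + v = Word (letters u @ letters v)"

instance by standard (simp_all add: zero_gen_word_def plus_gen_word_def)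

end

text \<open>
  Both the free algebra and the polynomial algebra are monoid algebras \<open>'m \<Rightarrow>\<^sub>0 'k\<close>: over words in
  the generators, respectively over finite multisets of generators (commutative monomials).
\<close>

type_synonym 'k free_alg = "gen_word \<Rightarrow>\<^sub>0 'k"
type_synonym 'k poly_alg = "gen multiset \<Rightarrow>\<^sub>0 'k"

definition free_gen :: "gen \<Rightarrow> 'k::field free_alg" where
  "free_gen g = Poly_Mapping.single (Word [g]) 1"
definition poly_gen :: "gen \<Rightarrow> 'k::field poly_alg" where
  "poly_gen g = Poly_Mapping.single {#g#} 1"

definition scale_free :: "'k::field \<Rightarrow> ('m::monoid_add \<Rightarrow>\<^sub>0 'k) \<Rightarrow> ('m \<Rightarrow>\<^sub>0 'k)" (infixr \<open>\<bullet>\<close> 70) where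
  "c \<bullet> x = Poly_Mapping.single 0 c * x"

inductive_set two_sided_ideal :: "'a::ring_1 set \<Rightarrow> 'a set" for S where
  base: "x \<in> S \<Longrightarrow> x \<in> two_sided_ideal S"
| zero: "0 \<in> two_sided_ideal S"
| add: "x \<in> two_sided_ideal S \<Longrightarrow> y \<in> two_sided_ideal S \<Longrightarrow> x + y \<in> two_sided_ideal S"
| mult_left: "x \<in> two_sided_ideal S \<Longrightarrow> a * x \<in> two_sided_ideal S"
| mult_right: "x \<in> two_sided_ideal S \<Longrightarrow> x * a \<in> two_sided_ideal S"

lemma ideal_uminus: "x \<in> two_sided_ideal S \<Longrightarrow> - x \<in> two_sided_ideal S"
  using two_sided_ideal.mult_left[of x S "- 1"] by simp

lemma equivp_ideal: "equivp (\<lambda>x y. x - y \<in> two_sided_ideal S)"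
proof (rule equivpI)
  show "reflp (\<lambda>x y. x - y \<in> two_sided_ideal S)"
    by (simp add: reflp_def two_sided_ideal.zero)
  show "symp (\<lambda>x y. x - y \<in> two_sided_ideal S)"
    using ideal_uminus by (fastforce simp: symp_def)
  show "transp (\<lambda>x y. x - y \<in> two_sided_ideal S)"
    using two_sided_ideal.add by (fastforce simp: transp_def)
qed

lemma ideal_cong_add:
  assumes "x - x' \<in> two_sided_ideal S" "y - y' \<in> two_sided_ideal S"
  shows "(x + y) - (x' + y') \<in> two_sided_ideal S"
  using two_sided_ideal.add[OF assms] by (simp add: algebra_simps)

lemma ideal_cong_uminus:
  assumes "x - x' \<in> two_sided_ideal S"
  shows "(- x) - (- x') \<in> two_sided_ideal S"
  using ideal_uminus[OF assms] by simp

lemma ideal_cong_diff: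
  assumes "x - x' \<in> two_sided_ideal S" "y - y' \<in> two_sided_ideal S"
  shows "(x - y) - (x' - y') \<in> two_sided_ideal S"
  using two_sided_ideal.add[OF assms(1) ideal_uminus[OF assms(2)]] by (simp add: algebra_simps)

lemma ideal_cong_mult:
  assumes "x - x' \<in> two_sided_ideal S" "y - y' \<in> two_sided_ideal S"
  shows "x * y - x' * y' \<in> two_sided_ideal S"
proof -
  have "(x - x') * y + x' * (y - y') \<in> two_sided_ideal S"
    by (intro two_sided_ideal.add two_sided_ideal.mult_left two_sided_ideal.mult_right assms)
  then show ?thesis by (simp add: algebra_simps)
qed


section \<open>The algebra over \<open>\<complex>(q\<^sup>1\<^sup>/\<^sup>4, t\<^sup>1\<^sup>/\<^sup>4)\<close>\<close>

definition qcomm :: "int \<Rightarrow> kqt free_alg \<Rightarrow> kqt free_alg \<Rightarrow> kqt free_alg" where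
  "qcomm j A B =
    (1 / (q4 powi 2 - q4 powi (-2))) \<bullet> ((q4 powi j) \<bullet> (A * B) - (q4 powi (- j)) \<bullet> (B * A))"

definition theta :: kqt where
  "theta = (q4 ^ 4 + t4 ^ 4) * q4 powi (-2) * t4 powi (-2)"

text \<open>Each defining relation \<open>lhs = rhs\<close> is represented by the element \<open>lhs - rhs\<close>.\<close>

definition local_rels_qt :: "nat \<Rightarrow> kqt free_alg set" where
  "local_rels_qt i =
    (let S = (\<lambda>i. free_gen (single_gen i));
         D = (\<lambda>i. free_gen (double_gen i));
         E = (\<lambda>i. free_gen (triple_gen i));
         q = q4 ^ 4
     in {qcomm 1 (S i) (S (i+1)) - D i,

         qcomm 1 (D i) (S i) - S (i+1),
         qcomm 1 (S (i+1)) (D i) - S i,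
         qcomm 1 (D i) (S (i+2)) - E i,
         qcomm 1 (S (i+5)) (D i) - E (i+5),
         D i * S (i+3) - S (i+3) * D i,
         D i * S (i+4) - S (i+4) * D i,

         qcomm 1 (E i) (S i) - D (i+1),
         qcomm 1 (S (i+2)) (E i) - D i,
         E i * S (i+1) - S (i+1) * E i,

         qcomm 2 (D (i+1)) (D i)
           - ((q4 powi (-2) * (q + 1)) \<bullet> (S i * S (i+2)) - theta \<bullet> S (i+4)),
         qcomm 1 (D i) (D (i+2)) - D (i+4),
         D i * D (i+3) - D (i+3) * D i,

         qcomm 1 (E i) (D i) - S (i+2),
         qcomm 1 (D (i+1)) (E i) - S i,
         qcomm 0 (E i) (D (i+2)) - (S (i+2) * D (i+4) - S (i+3) * D i)})"

definition triple_rels_qt :: "kqt free_alg set" where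
  "triple_rels_qt =
    (let X = free_gen; q = q4 ^ 4
     in {qcomm 2 (X O123) (X O345)
           - (- (theta \<bullet> (X O1 * X O5 * X O6))
              + (theta * q4 powi (-1)) \<bullet> (X O5 * X O61) + (theta * q4) \<bullet> (X O1 * X O56)
              - theta \<bullet> X O234 + (q4 powi (-2) * (q + 1)) \<bullet> (X O3 * X O6)),
         qcomm 2 (X O234) (X O123)
           - (- (theta \<bullet> (X O2 * X O6 * X O1))
              + (theta * q4 powi (-1)) \<bullet> (X O6 * X O12) + (theta * q4) \<bullet> (X O2 * X O61)
              - theta \<bullet> X O345 + (q4 powi (-2) * (q + 1)) \<bullet> (X O4 * X O1)),
         qcomm 2 (X O345) (X O234)
           - (- (theta \<bullet> (X O3 * X O1 * X O2))
              + (theta * q4 powi (-1)) \<bullet> (X O1 * X O23) + (theta * q4) \<bullet> (X O3 * X O12)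
              - theta \<bullet> X O123 + (q4 powi (-2) * (q + 1)) \<bullet> (X O5 * X O2))})"

definition casimir_qt :: "kqt free_alg" where
  "casimir_qt =
    (let X = free_gen;
         S = (\<lambda>i. X (single_gen i));
         D = (\<lambda>i. X (double_gen i));
         E = (\<lambda>i. X (triple_gen i));
         q = q4 ^ 4; t = t4 ^ 4
     in (1/3) \<bullet> (X O123 * X O234 * X O345 + X O234 * X O345 * X O123 + X O345 * X O123 * X O234)
      - (1/6 * q4 powi (-2) * (q^2 + 2)) \<bullet> (\<Sum>i=1..6. S i * S (i+3) * E (i+2))
      + (1/6 * q4 powi (-5) * t4 powi (-2) * (2*q + 1) * (q + t)) \<bullet>
          (\<Sum>i=1..6. S (i+1) * S i * D i)
      - (1/3 * q4 powi 2) \<bullet> (\<Sum>i=1..6. S i * S (i+2) * S (i+4))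
      - (1/6 * q4 powi (-6) * t4 powi (-2) * (2*q + 1) * (q + t)) \<bullet> (\<Sum>i=1..6. (D i)^2)
      + (1/6 * q4 powi (-6) * t4 powi (-2) * (q - 1) * (q + t)) \<bullet> (\<Sum>i=1..6. (S i)^2)
      + (q4 powi (-6) * t4 powi (-6) * (t + 1) * (q + t) * (q^2 + t)) \<bullet> 1)"

definition rels_qt :: "kqt free_alg set" where
  "rels_qt =
    (\<Union>i\<in>{1..6}. local_rels_qt i)
    \<union> {free_gen (single_gen i) * free_gen (single_gen j)
        - free_gen (single_gen j) * free_gen (single_gen i)
       | i j. i \<in> {1..6} \<and> j \<in> {1..6} \<and> (int i - int j) mod 6 \<notin> {0, 1, 5}}
    \<union> triple_rels_qt \<union> {casimir_qt}"

text \<open>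
  The class \<^class>\<open>ring_1\<close> is avoided for the quotients because it includes \<open>0 \<noteq> 1\<close>.
\<close>

definition cong_Aqt :: "kqt free_alg \<Rightarrow> kqt free_alg \<Rightarrow> bool" where
  "cong_Aqt x y \<longleftrightarrow> x - y \<in> two_sided_ideal rels_qt"

quotient_type Aqt = "kqt free_alg" / cong_Aqt
  unfolding cong_Aqt_def by (rule equivp_ideal)

instantiation Aqt :: "{ring, monoid_mult}"
begin

lift_definition zero_Aqt :: Aqt is 0 .
lift_definition one_Aqt :: Aqt is 1 .
lift_definition plus_Aqt :: "Aqt \<Rightarrow> Aqt \<Rightarrow> Aqt" is "(+)"
  unfolding cong_Aqt_def by (rule ideal_cong_add)
lift_definition uminus_Aqt :: "Aqt \<Rightarrow> Aqt" is uminus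
  unfolding cong_Aqt_def by (rule ideal_cong_uminus)
lift_definition minus_Aqt :: "Aqt \<Rightarrow> Aqt \<Rightarrow> Aqt" is "(-)"
  unfolding cong_Aqt_def by (rule ideal_cong_diff)
lift_definition times_Aqt :: "Aqt \<Rightarrow> Aqt \<Rightarrow> Aqt" is "(*)"
  unfolding cong_Aqt_def by (rule ideal_cong_mult)

instance
  by standard
    (transfer, simp add: cong_Aqt_def algebra_simps two_sided_ideal.zero)+

end

definition scale_Aqt :: "kqt \<Rightarrow> Aqt \<Rightarrow> Aqt" where
  "scale_Aqt c x = abs_Aqt (Poly_Mapping.single 0 c) * x"

lemma scale_Aqt_abs: "scale_Aqt c (abs_Aqt x) = abs_Aqt (c \<bullet> x)"
  by (simp add: scale_Aqt_def scale_free_def times_Aqt.abs_eq)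

interpretation Aqt: vector_space scale_Aqt
proof
  fix c d :: kqt and x y :: Aqt
  show "scale_Aqt c (x + y) = scale_Aqt c x + scale_Aqt c y"
    by (simp add: scale_Aqt_def distrib_left)
  show "scale_Aqt (c + d) x = scale_Aqt c x + scale_Aqt d x"
    by (simp add: scale_Aqt_def single_add distrib_right flip: plus_Aqt.abs_eq)
  show "scale_Aqt c (scale_Aqt d x) = scale_Aqt (c * d) x"
    by (simp add: scale_Aqt_def times_Aqt.abs_eq mult_single flip: mult.assoc)
  show "scale_Aqt 1 x = x"
    by (simp add: scale_Aqt_def flip: one_Aqt.abs_eq)
qed

lift_definition gen_Aqt :: "gen \<Rightarrow> Aqt" is free_gen .


section \<open>The commutative algebras\<close>

definition rels_comm :: "'k::field \<Rightarrow> 'k poly_alg set" where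
  "rels_comm kappa =
    (let S = (\<lambda>i. poly_gen (single_gen i));
         D = (\<lambda>i. poly_gen (double_gen i));
         E = (\<lambda>i. poly_gen (triple_gen i))
     in (\<Union>i\<in>{1..6}.
          {S (i+2) * S (i+4) + S (i+3) * E (i+2) - D (i+2) * D (i+3) - kappa \<bullet> S i,
           - S (i+3) * D (i+5) - S (i+4) * D (i+1) + D (i+3) * E (i+1)
             - kappa \<bullet> (D i - S i * S (i+1)),
           - D (i+1) * D (i+4) + E i * E (i+1) - S i * S (i+3)
             - kappa \<bullet> (- E (i+2) + S (i+1) * D (i+5) + S (i+5) * D i
                          - S i * S (i+1) * S (i+5))})
      \<union> {E 1 * E 2 * E 3
          - (\<Sum>i=1..3. S i * S (i+3) * E (i+2))
          + (kappa / 2) \<bullet> (\<Sum>i=1..6. S (i+1) * S i * D i)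
          - (S 1 * S 3 * S 5 + S 2 * S 4 * S 6)
          - (kappa / 2) \<bullet> (\<Sum>i=1..6. (D i)^2)
          + (kappa ^ 3) \<bullet> 1})"

definition rels_t :: "kt poly_alg set" where
  "rels_t = rels_comm (s4 powi 2 + s4 powi (-2))"

definition rels_1 :: "complex poly_alg set" where
  "rels_1 = rels_comm 2"

definition cong_At :: "kt poly_alg \<Rightarrow> kt poly_alg \<Rightarrow> bool" where
  "cong_At x y \<longleftrightarrow> x - y \<in> two_sided_ideal rels_t"

quotient_type At = "kt poly_alg" / cong_At
  unfolding cong_At_def by (rule equivp_ideal)

instantiation At :: "{comm_ring, comm_monoid_mult}"
begin

lift_definition zero_At :: At is 0 .
lift_definition one_At :: At is 1 .
lift_definition plus_At :: "At \<Rightarrow> At \<Rightarrow> At" is "(+)"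
  unfolding cong_At_def by (rule ideal_cong_add)
lift_definition uminus_At :: "At \<Rightarrow> At" is uminus
  unfolding cong_At_def by (rule ideal_cong_uminus)
lift_definition minus_At :: "At \<Rightarrow> At \<Rightarrow> At" is "(-)"
  unfolding cong_At_def by (rule ideal_cong_diff)
lift_definition times_At :: "At \<Rightarrow> At \<Rightarrow> At" is "(*)"
  unfolding cong_At_def by (rule ideal_cong_mult)

instance
  by standard
    (transfer, simp add: cong_At_def algebra_simps two_sided_ideal.zero)+

end

definition scale_At :: "kt \<Rightarrow> At \<Rightarrow> At" where
  "scale_At c x = abs_At (Poly_Mapping.single 0 c) * x"

lemma scale_At_abs: "scale_At c (abs_At x) = abs_At (c \<bullet> x)"
  by (simp add: scale_At_def scale_free_def times_At.abs_eq)

interpretation At: vector_space scale_At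
proof
  fix c d :: kt and x y :: At
  show "scale_At c (x + y) = scale_At c x + scale_At c y"
    by (simp add: scale_At_def distrib_left)
  show "scale_At (c + d) x = scale_At c x + scale_At d x"
    by (simp add: scale_At_def single_add distrib_right flip: plus_At.abs_eq)
  show "scale_At c (scale_At d x) = scale_At (c * d) x"
    by (simp add: scale_At_def times_At.abs_eq mult_single flip: mult.assoc)
  show "scale_At 1 x = x"
    by (simp add: scale_At_def flip: one_At.abs_eq)
qed

lift_definition gen_At :: "gen \<Rightarrow> At" is poly_gen .

definition cong_A1 :: "complex poly_alg \<Rightarrow> complex poly_alg \<Rightarrow> bool" where
  "cong_A1 x y \<longleftrightarrow> x - y \<in> two_sided_ideal rels_1"

quotient_type A1 = "complex poly_alg" / cong_A1
  unfolding cong_A1_def by (rule equivp_ideal)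

instantiation A1 :: "{comm_ring, comm_monoid_mult}"
begin

lift_definition zero_A1 :: A1 is 0 .
lift_definition one_A1 :: A1 is 1 .
lift_definition plus_A1 :: "A1 \<Rightarrow> A1 \<Rightarrow> A1" is "(+)"
  unfolding cong_A1_def by (rule ideal_cong_add)
lift_definition uminus_A1 :: "A1 \<Rightarrow> A1" is uminus
  unfolding cong_A1_def by (rule ideal_cong_uminus)
lift_definition minus_A1 :: "A1 \<Rightarrow> A1 \<Rightarrow> A1" is "(-)"
  unfolding cong_A1_def by (rule ideal_cong_diff)
lift_definition times_A1 :: "A1 \<Rightarrow> A1 \<Rightarrow> A1" is "(*)"
  unfolding cong_A1_def by (rule ideal_cong_mult)

instance
  by standard
    (transfer, simp add: cong_A1_def algebra_simps two_sided_ideal.zero)+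

end

definition scale_A1 :: "complex \<Rightarrow> A1 \<Rightarrow> A1" where
  "scale_A1 c x = abs_A1 (Poly_Mapping.single 0 c) * x"

lemma scale_A1_abs: "scale_A1 c (abs_A1 x) = abs_A1 (c \<bullet> x)"
  by (simp add: scale_A1_def scale_free_def times_A1.abs_eq)

interpretation A1: vector_space scale_A1
proof
  fix c d :: complex and x y :: A1
  show "scale_A1 c (x + y) = scale_A1 c x + scale_A1 c y"
    by (simp add: scale_A1_def distrib_left)
  show "scale_A1 (c + d) x = scale_A1 c x + scale_A1 d x"
    by (simp add: scale_A1_def single_add distrib_right flip: plus_A1.abs_eq)
  show "scale_A1 c (scale_A1 d x) = scale_A1 (c * d) x"
    by (simp add: scale_A1_def times_A1.abs_eq mult_single flip: mult.assoc)
  show "scale_A1 1 x = x"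
    by (simp add: scale_A1_def flip: one_A1.abs_eq)
qed

lift_definition gen_A1 :: "gen \<Rightarrow> A1" is poly_gen .


section \<open>The monomial bases and structure constants\<close>

text \<open>
  A normally ordered monomial is given by the multiset of its letters, i.e. by the exponents
  \<open>n\<^sub>1, \<dots>, n\<^sub>1\<^sub>5\<close>; divisibility of the commutative counterparts is inclusion of multisets.
\<close>

definition forbidden :: "gen multiset set" where
  "forbidden = {
    {#O56, O61#}, {#O12, O61#}, {#O45, O56#}, {#O34, O45#}, {#O23, O34#}, {#O12, O23#},
    {#O3, O4, O5#}, {#O2, O3, O4#}, {#O1, O2, O3#}, {#O56, O345#}, {#O23, O345#}, {#O45, O234#},
    {#O12, O234#}, {#O61, O123#}, {#O34, O123#}, {#O3, O4, O34#}, {#O2, O3, O23#}, {#O1, O2, O12#},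
    {#O234, O345#}, {#O123, O345#}, {#O123, O234#}, {#O4, O5, O6, O6#}, {#O1, O2, O6, O6#},
    {#O1, O5, O5, O6#}, {#O4, O4, O5, O6#}, {#O1, O4, O5, O6#}, {#O1, O2, O5, O6#},
    {#O1, O1, O5, O6#}, {#O1, O2, O2, O6#}, {#O1, O5, O6, O61#}, {#O1, O2, O6, O61#},
    {#O4, O5, O6, O56#}, {#O1, O5, O6, O56#}, {#O4, O5, O6, O45#}, {#O1, O2, O6, O45#},
    {#O5, O6, O6, O34#}, {#O1, O5, O6, O34#}, {#O1, O2, O6, O34#}, {#O1, O1, O2, O34#},
    {#O1, O6, O6, O23#}, {#O4, O5, O6, O23#}, {#O1, O5, O6, O23#}, {#O4, O5, O5, O23#},
    {#O5, O5, O6, O12#}, {#O4, O5, O6, O12#}, {#O3, O4, O4, O12#}, {#O1, O2, O6, O345#},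
    {#O1, O5, O6, O234#}, {#O4, O5, O6, O123#}, {#O1, O6, O45, O61#}, {#O4, O5, O45, O61#},
    {#O2, O3, O45, O61#}, {#O1, O6, O23, O61#}, {#O4, O5, O23, O61#}, {#O5, O6, O34, O56#},
    {#O1, O2, O34, O56#}, {#O5, O6, O12, O56#}, {#O3, O4, O12, O56#}, {#O1, O6, O23, O45#},
    {#O4, O5, O23, O45#}, {#O5, O6, O12, O34#}}"

definition B :: "gen multiset set" where
  "B = {n. \<not> (\<exists>m\<in>forbidden. m \<subseteq># n)}"

definition monomial :: "(gen \<Rightarrow> 'a::monoid_mult) \<Rightarrow> gen multiset \<Rightarrow> 'a" where
  "monomial x n = prod_list (map (\<lambda>g. x g ^ count n g)
    [O1, O2, O3, O4, O5, O6, O12, O23, O34, O45, O56, O61, O123, O234, O345])"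

text \<open>
  In the following, \<open>sc\<close> is the scalar multiplication of an algebra and \<open>x\<close> its family of
  generators. The first definition says that the family \<open>(monomial x b)\<close> for \<open>b \<in> B\<close> is a basis.
\<close>

definition B_is_basis :: "('k::field \<Rightarrow> 'a::{ring, monoid_mult} \<Rightarrow> 'a) \<Rightarrow> (gen \<Rightarrow> 'a) \<Rightarrow> bool" where
  "B_is_basis sc x \<longleftrightarrow>
    inj_on (monomial x) B \<and>
    \<not> module.dependent sc (monomial x ` B) \<and>
    module.span sc (monomial x ` B) = UNIV"

definition struct_const ::
    "('k::field \<Rightarrow> 'a::{ring, monoid_mult} \<Rightarrow> 'a) \<Rightarrow> (gen \<Rightarrow> 'a) \<Rightarrow>
      gen multiset \<Rightarrow> gen multiset \<Rightarrow> gen multiset \<Rightarrow> 'k" where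
  "struct_const sc x b1 b2 b3 =
    module.representation sc (monomial x ` B) (monomial x b1 * monomial x b2) (monomial x b3)"

end

theory Submission
  imports Defs "HOL-Computational_Algebra.Polynomial_Factorial"
begin

text \<open>
  Let \<open>K\<close> be \<open>\<complex>(t\<^sup>1\<^sup>/\<^sup>4)\<close> with \<open>y = t\<^sup>1\<^sup>/\<^sup>4\<close>, or \<open>\<complex>\<close> with \<open>y = 1\<close>, and let \<open>ev\<close> be the evaluation of
  Laurent polynomials at \<open>q\<^sup>1\<^sup>/\<^sup>4 = 1\<close>, \<open>t\<^sup>1\<^sup>/\<^sup>4 = y\<close>. Because the structure constants of the
  noncommutative algebra in the basis \<open>B\<close> are Laurent polynomials, the Laurent combinations of \<open>B\<close>
  form a subring \<open>L\<close>, and the elements of \<open>L\<close> all of whose coordinates vanish under \<open>ev\<close> form a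
  two-sided ideal of \<open>L\<close>. After extension of scalars to \<open>K\<close>, the quotient, called the reduction of
  \<open>L\<close>, has the images of the elements of \<open>B\<close> as a basis, and its structure constants are the specialized ones.
  The theorem says that they agree with those of the commutative algebra.

  For any two generators \<open>A\<close>, \<open>A'\<close> a defining relation states
  \<open>q\<^sup>j\<^sup>/\<^sup>4 A A' - q\<^sup>-\<^sup>j\<^sup>/\<^sup>4 A' A = (q\<^sup>1\<^sup>/\<^sup>2 - q\<^sup>-\<^sup>1\<^sup>/\<^sup>2) C\<close> with \<open>C\<close> in \<open>L\<close>, or that they commute. At \<open>q = 1\<close> the right-hand side
  vanishes, so the reduction is commutative and receives a homomorphism from the polynomial algebra
  over \<open>K\<close> (the map \<open>reduce\<close>). The essential point is that this homomorphism kills the relations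
  of the commutative algebra.

  The relation with constant term \<open>\<kappa>\<^sup>3\<close> is the \<open>q\<close>-Casimir relation at \<open>q = 1\<close>. The other ones are not specializations
  of defining relations, for at \<open>q = 1\<close> the \<open>q\<close>-commutators only yield commutativity. They are
  the first-order information in \<open>q - 1\<close>: a \<open>q\<close>-commutator of two generators can be computed by
  expanding one of them as a \<open>q\<close>-commutator of smaller generators, and comparison with the
  relation for it gives an identity divisible by \<open>q\<^sup>1\<^sup>/\<^sup>2 - q\<^sup>-\<^sup>1\<^sup>/\<^sup>2\<close>, which can be cancelled over the
  field \<open>\<complex>(q\<^sup>1\<^sup>/\<^sup>4, t\<^sup>1\<^sup>/\<^sup>4)\<close>. With all indices read cyclically this gives the exact identity
  \<open>D_D_product\<close>; \<open>q\<close>-commuting it with a single generator gives \<open>E_D_product\<close>, and \<open>q\<close>-commuting the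
  result with another one gives \<open>E_E_product\<close>. At \<open>q = 1\<close> these are the remaining three families of
  relations.

  Hence the homomorphism factors through the commutative algebra. It sends each commutative counterpart
  of an element of \<open>B\<close> to the image of that element in the reduction, so expanding a product of
  two of them on both sides and comparing coefficients identifies the structure constants.
\<close>

section \<open>Specialization of Laurent polynomials at \<open>q\<^sup>1\<^sup>/\<^sup>4 = 1\<close>\<close>

lemma q4_eq_to_fract: "q4 = to_fract [:0, 1:]"
  and t4_eq_to_fract: "t4 = to_fract [:[:0, 1:]:]"
  and const_kqt_eq_to_fract: "const_kqt c = to_fract [:[:c:]:]"
  and const_kt_eq_to_fract: "const_kt c = to_fract [:c:]"
  by (simp_all add: q4_def t4_def const_kqt_def const_kt_def to_fract_def)

lemma q4_nonzero: "q4 \<noteq> 0" and t4_nonzero: "t4 \<noteq> 0"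
  by (simp_all add: q4_eq_to_fract t4_eq_to_fract)

locale ring_specialization =
  fixes R :: "'k::field set" and ev :: "'k \<Rightarrow> 'l::field"
  assumes R_1: "1 \<in> R" and R_uminus: "a \<in> R \<Longrightarrow> - a \<in> R"
    and R_add: "a \<in> R \<Longrightarrow> b \<in> R \<Longrightarrow> a + b \<in> R"
    and R_mult: "a \<in> R \<Longrightarrow> b \<in> R \<Longrightarrow> a * b \<in> R"
    and ev_1: "ev 1 = 1"
    and ev_add: "a \<in> R \<Longrightarrow> b \<in> R \<Longrightarrow> ev (a + b) = ev a + ev b"
    and ev_mult: "a \<in> R \<Longrightarrow> b \<in> R \<Longrightarrow> ev (a * b) = ev a * ev b"
begin

lemma R_0: "0 \<in> R"
  using R_add[OF R_1 R_uminus[OF R_1]] by simp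

lemma ev_0: "ev 0 = 0"
  using ev_add[OF R_0 R_0] by (metis add.right_neutral add_left_cancel)

lemma ev_uminus: "a \<in> R \<Longrightarrow> ev (- a) = - ev a"
  using ev_add[OF _ R_uminus, of a a] by (simp add: ev_0 eq_neg_iff_add_eq_0 add.commute)

lemma R_diff: "a \<in> R \<Longrightarrow> b \<in> R \<Longrightarrow> a - b \<in> R"
  using R_add[OF _ R_uminus] by force

lemma ev_diff: "a \<in> R \<Longrightarrow> b \<in> R \<Longrightarrow> ev (a - b) = ev a - ev b"
  using ev_add[OF _ R_uminus, of a b] by (simp add: ev_uminus)

lemma R_sum: "(\<And>i. i \<in> I \<Longrightarrow> f i \<in> R) \<Longrightarrow> sum f I \<in> R"
  by (induction I rule: infinite_finite_induct) (auto intro: R_0 R_add)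

lemma ev_sum: "(\<And>i. i \<in> I \<Longrightarrow> f i \<in> R) \<Longrightarrow> ev (sum f I) = (\<Sum>i\<in>I. ev (f i))"
  by (induction I rule: infinite_finite_induct) (auto simp: ev_0 ev_add R_sum)

lemma R_power: "a \<in> R \<Longrightarrow> a ^ n \<in> R"
  by (induction n) (auto intro: R_1 R_mult)

lemma ev_power: "a \<in> R \<Longrightarrow> ev (a ^ n) = ev a ^ n"
  by (induction n) (auto simp: ev_1 ev_mult R_power)

lemma of_nat_R: "of_nat n \<in> R" "ev (of_nat n) = of_nat n"
  by (induction n) (auto simp: ev_0 ev_1 ev_add R_1 intro: R_0 R_add)

lemma R_numeral: "numeral n \<in> R" and ev_numeral: "ev (numeral n) = numeral n"
  using of_nat_R[of "numeral n"] by simp_all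

lemma ev_inverse:
  assumes "a \<in> R" "inverse a \<in> R" "a \<noteq> 0"
  shows "ev (inverse a) = inverse (ev a)"
proof -
  have "ev a * ev (inverse a) = 1"
    using assms by (simp add: ev_1 flip: ev_mult)
  then show ?thesis
    by (metis inverse_unique)
qed

lemma power_int_R:
  assumes "a \<in> R" "inverse a \<in> R" "a \<noteq> 0"
  shows "a powi n \<in> R" "ev (a powi n) = ev a powi n"
  using assms by (simp_all add: power_int_def R_power ev_power ev_inverse)

end

text \<open>
  A point \<open>(1, y)\<close> at which Laurent polynomials in \<open>q\<^sup>1\<^sup>/\<^sup>4\<close> and \<open>t\<^sup>1\<^sup>/\<^sup>4\<close> are evaluated, with values in an
  extension field of \<open>\<complex>\<close>.
\<close>

locale laurent_point =
  fixes emb :: "complex \<Rightarrow> 'l::field" and y :: 'l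
  assumes emb_0: "emb 0 = 0" and emb_1: "emb 1 = 1"
    and emb_add: "emb (a + b) = emb a + emb b" and emb_mult: "emb (a * b) = emb a * emb b"
    and y_nonzero: "y \<noteq> 0"

lemma poly_map_poly_add:
  assumes "f 0 = 0" "\<And>a b. f (a + b) = f a + f b"
  shows "poly (map_poly f (p + q)) x = poly (map_poly f p) x + poly (map_poly f q) x"
proof -
  have "map_poly f (p + q) = map_poly f p + map_poly f q"
    by (rule poly_eqI) (simp add: coeff_map_poly assms)
  then show ?thesis by simp
qed

lemma poly_map_poly_mult:
  fixes f :: "'a::comm_ring_1 \<Rightarrow> 'b::comm_ring_1"
  assumes "f 0 = 0" "\<And>a b. f (a + b) = f a + f b" "\<And>a b. f (a * b) = f a * f b"
  shows "poly (map_poly f (p * q)) x = poly (map_poly f p) x * poly (map_poly f q) x"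
  by (induction p)
    (simp_all add: assms poly_map_poly_add map_poly_pCons map_poly_smult algebra_simps)

context laurent_point
begin

definition poly_ev :: "complex poly poly \<Rightarrow> 'l" where
  "poly_ev p = poly (map_poly (\<lambda>r. poly (map_poly emb r) y) p) 1"

lemma poly_ev_add: "poly_ev (p + r) = poly_ev p + poly_ev r"
  and poly_ev_mult: "poly_ev (p * r) = poly_ev p * poly_ev r"
  by (simp_all add: poly_ev_def poly_map_poly_add poly_map_poly_mult emb_0 emb_add emb_mult)

lemma poly_ev_gens: "poly_ev [:0, 1:] = 1" "poly_ev [:[:0, 1:]:] = y" "poly_ev [:[:c:]:] = emb c"
  by (simp_all add: poly_ev_def map_poly_pCons emb_0 emb_1)

lemma poly_ev_power: "poly_ev (p ^ n) = poly_ev p ^ n"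
  using poly_ev_gens(3)[of 1] by (induction n) (simp_all add: poly_ev_mult emb_1 pCons_one)

text \<open>
  Laurent polynomials appear here as elements of the rational function field that become
  polynomials after multiplication with powers of \<open>q\<^sup>1\<^sup>/\<^sup>4\<close> and \<open>t\<^sup>1\<^sup>/\<^sup>4\<close>. A relation, rather than a
  function of the exponents, makes sums and products easy; that the value depends only on the
  element of the field is \<open>specializes_unique\<close>.
\<close>

definition specializes :: "kqt \<Rightarrow> 'l \<Rightarrow> bool" where
  "specializes u v \<longleftrightarrow> (\<exists>p a b. u * q4 ^ a * t4 ^ b = to_fract p \<and> v * y ^ b = poly_ev p)"

lemma to_fract_power: "to_fract (p ^ n) = to_fract p ^ n"
  by (induction n) simp_all

text \<open>
  Clearing denominators turns two representations of the same field element into an equation of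
  polynomials, which may be evaluated; division by powers of \<open>y\<close> is harmless since \<open>y \<noteq> 0\<close>.
\<close>

lemma specializes_unique:
  assumes "specializes u v" "specializes u v'"
  shows "v = v'"
proof -
  obtain p a b where p: "u * q4 ^ a * t4 ^ b = to_fract p" "v * y ^ b = poly_ev p"
    using assms(1) by (auto simp: specializes_def)
  obtain p' a' b' where p': "u * q4 ^ a' * t4 ^ b' = to_fract p'" "v' * y ^ b' = poly_ev p'"
    using assms(2) by (auto simp: specializes_def)
  let ?X = "[:0, 1:] :: complex poly poly" and ?Y = "[:[:0, 1:]:] :: complex poly poly"
  have "to_fract (p * ?X ^ a' * ?Y ^ b') = to_fract (p' * ?X ^ a * ?Y ^ b)"
    by (simp only: to_fract_mult to_fract_power flip: p(1) p'(1) q4_eq_to_fract t4_eq_to_fract)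
      (simp add: mult_ac)
  then have "p * ?X ^ a' * ?Y ^ b' = p' * ?X ^ a * ?Y ^ b"
    by (simp only: to_fract_eq_iff)
  then have "poly_ev (p * ?X ^ a' * ?Y ^ b') = poly_ev (p' * ?X ^ a * ?Y ^ b)"
    by simp
  then have "v * (y ^ b * y ^ b') = v' * (y ^ b * y ^ b')"
    by (simp add: poly_ev_mult poly_ev_power poly_ev_gens mult_ac flip: p(2) p'(2)
        del: mult_pCons_left mult_pCons_right)
  then show ?thesis
    using y_nonzero by simp
qed

lemma specializes_add:
  assumes "specializes u v" "specializes u' v'"
  shows "specializes (u + u') (v + v')"
proof -
  obtain p a b where p: "u * q4 ^ a * t4 ^ b = to_fract p" "v * y ^ b = poly_ev p"
    using assms(1) by (auto simp: specializes_def)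
  obtain p' a' b' where p': "u' * q4 ^ a' * t4 ^ b' = to_fract p'" "v' * y ^ b' = poly_ev p'"
    using assms(2) by (auto simp: specializes_def)
  let ?X = "[:0, 1:] :: complex poly poly" and ?Y = "[:[:0, 1:]:] :: complex poly poly"
  have "(u + u') * q4 ^ (a + a') * t4 ^ (b + b')
      = (u * q4 ^ a * t4 ^ b) * q4 ^ a' * t4 ^ b' + (u' * q4 ^ a' * t4 ^ b') * q4 ^ a * t4 ^ b"
    by (simp add: power_add algebra_simps)
  also have "\<dots> = to_fract (p * ?X ^ a' * ?Y ^ b' + p' * ?X ^ a * ?Y ^ b)"
    by (simp only: to_fract_mult to_fract_add to_fract_power flip: p(1) p'(1) q4_eq_to_fract t4_eq_to_fract)
  finally have 1: "(u + u') * q4 ^ (a + a') * t4 ^ (b + b')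
      = to_fract (p * ?X ^ a' * ?Y ^ b' + p' * ?X ^ a * ?Y ^ b)" .
  have "(v + v') * y ^ (b + b') = (v * y ^ b) * y ^ b' + (v' * y ^ b') * y ^ b"
    by (simp add: power_add algebra_simps)
  also have "\<dots> = poly_ev (p * ?X ^ a' * ?Y ^ b' + p' * ?X ^ a * ?Y ^ b)"
    by (simp only: poly_ev_mult poly_ev_add poly_ev_power poly_ev_gens p(2) p'(2)) simp
  finally show ?thesis
    unfolding specializes_def using 1 by blast
qed

lemma specializes_mult:
  assumes "specializes u v" "specializes u' v'"
  shows "specializes (u * u') (v * v')"
proof -
  obtain p a b where p: "u * q4 ^ a * t4 ^ b = to_fract p" "v * y ^ b = poly_ev p"
    using assms(1) by (auto simp: specializes_def)
  obtain p' a' b' where p': "u' * q4 ^ a' * t4 ^ b' = to_fract p'" "v' * y ^ b' = poly_ev p'"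
    using assms(2) by (auto simp: specializes_def)
  have "u * u' * q4 ^ (a + a') * t4 ^ (b + b') = to_fract (p * p')"
    by (simp add: power_add mult_ac flip: p(1) p'(1))
  moreover have "v * v' * y ^ (b + b') = poly_ev (p * p')"
    by (simp add: power_add poly_ev_mult mult_ac flip: p(2) p'(2))
  ultimately show ?thesis
    unfolding specializes_def by blast
qed

lemma specializes_poly: "specializes (to_fract p) (poly_ev p)"
  unfolding specializes_def by (rule exI[of _ p], rule exI[of _ 0], rule exI[of _ 0]) simp

lemma specializes_const: "specializes (const_kqt c) (emb c)"
  and specializes_q4: "specializes q4 1" and specializes_t4: "specializes t4 y"
  using specializes_poly[of "[:[:c:]:]"] specializes_poly[of "[:0, 1:]"] specializes_poly[of "[:[:0, 1:]:]"]
  by (simp_all add: poly_ev_gens const_kqt_eq_to_fract q4_eq_to_fract t4_eq_to_fract)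

lemma specializes_inverse_q4: "specializes (inverse q4) 1"
  unfolding specializes_def
proof (intro exI conjI)
  show "inverse q4 * q4 ^ 1 * t4 ^ 0 = to_fract [:[:1:]:]"
    by (simp add: q4_eq_to_fract pCons_one)
  show "1 * y ^ 0 = poly_ev [:[:1:]:]"
    by (simp add: poly_ev_gens emb_1)
qed

lemma specializes_inverse_t4: "specializes (inverse t4) (inverse y)"
  unfolding specializes_def
proof (intro exI conjI)
  show "inverse t4 * q4 ^ 0 * t4 ^ 1 = to_fract [:[:1:]:]"
    by (simp add: t4_eq_to_fract pCons_one)
  show "inverse y * y ^ 1 = poly_ev [:[:1:]:]"
    using y_nonzero by (simp add: poly_ev_gens emb_1)
qed

definition laurent_ring :: "kqt set" where
  "laurent_ring = {u. \<exists>v. specializes u v}"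

definition ev :: "kqt \<Rightarrow> 'l" where
  "ev u = (THE v. specializes u v)"

lemma ev_eq: "specializes u v \<Longrightarrow> ev u = v"
  unfolding ev_def using specializes_unique by blast

lemma specializes_iff: "specializes u v \<longleftrightarrow> u \<in> laurent_ring \<and> ev u = v"
  using ev_eq by (auto simp: laurent_ring_def)

sublocale ring_specialization laurent_ring ev
proof
  have "const_kqt (- c) = - const_kqt c" for c
    by (simp add: const_kqt_eq_to_fract flip: to_fract_uminus)
  moreover have "const_kqt 1 = 1"
    by (simp add: const_kqt_eq_to_fract pCons_one)
  ultimately have 1: "specializes 1 1" and m1: "specializes (- 1) (emb (- 1))"
    using specializes_const[of 1] specializes_const[of "- 1"] by (simp_all add: emb_1)
  show "1 \<in> laurent_ring" "ev 1 = 1"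
    using 1 by (simp_all add: specializes_iff)
  fix a b assume "a \<in> laurent_ring"
  then have a: "specializes a (ev a)" by (simp add: specializes_iff)
  show "- a \<in> laurent_ring"
    using specializes_mult[OF m1 a] by (simp add: specializes_iff)
  assume "b \<in> laurent_ring"
  then have b: "specializes b (ev b)" by (simp add: specializes_iff)
  show "a + b \<in> laurent_ring" "ev (a + b) = ev a + ev b" "a * b \<in> laurent_ring" "ev (a * b) = ev a * ev b"
    using specializes_add[OF a b] specializes_mult[OF a b] by (simp_all add: specializes_iff)
qed

lemma laurent_ring_gens: "q4 \<in> laurent_ring" "inverse q4 \<in> laurent_ring" "t4 \<in> laurent_ring"
    "inverse t4 \<in> laurent_ring" "const_kqt c \<in> laurent_ring"
  and ev_gens: "ev q4 = 1" "ev t4 = y" "ev (const_kqt c) = emb c"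
  using specializes_q4 specializes_inverse_q4 specializes_t4 specializes_inverse_t4
    specializes_const by (auto simp: specializes_iff)

lemmas laurent_ring_powi =
  power_int_R[OF laurent_ring_gens(1,2) q4_nonzero]
  power_int_R[OF laurent_ring_gens(3,4) t4_nonzero]

lemma ev_laurent_eval:
  "laurent_eval const_kqt q4 t4 C \<in> laurent_ring"
  "ev (laurent_eval const_kqt q4 t4 C) = laurent_eval emb 1 y C"
  unfolding laurent_eval_def
  by (auto simp: ev_sum ev_mult ev_gens laurent_ring_powi split_beta laurent_ring_gens R_mult
      intro!: R_sum)

lemma emb_of_nat: "emb (of_nat n) = of_nat n"
  by (induction n) (simp_all add: emb_0 emb_1 emb_add)

lemma emb_inverse_numeral: "emb (inverse (numeral n)) = inverse (numeral n)"
  and numeral_nonzero: "(numeral n :: 'l) \<noteq> 0"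
proof -
  have "numeral n * emb (inverse (numeral n)) = 1"
    using emb_mult[of "numeral n" "inverse (numeral n)"] emb_of_nat[of "numeral n"] emb_1 by simp
  then show "emb (inverse (numeral n)) = inverse (numeral n)" "(numeral n :: 'l) \<noteq> 0"
    by (metis inverse_unique, auto)
qed

end

text \<open>
  The embedding of constants into the field of rational functions is itself of this form, with
  an arbitrary nonzero second argument. It shows that inverses of numerals are constants in that field,
  hence Laurent polynomials.
\<close>

interpretation kqt: laurent_point const_kqt t4
proof
  show "t4 \<noteq> 0" by (rule t4_nonzero)
  show "const_kqt 0 = 0" "const_kqt 1 = 1"
    by (simp_all add: const_kqt_eq_to_fract pCons_one)
  show "const_kqt (a + b) = const_kqt a + const_kqt b" "const_kqt (a * b) = const_kqt a * const_kqt b" for a b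
    by (simp_all add: const_kqt_eq_to_fract flip: to_fract_add to_fract_mult)
qed

context laurent_point
begin

lemma divide_numeral:
  assumes "a \<in> laurent_ring"
  shows "a / numeral n \<in> laurent_ring" "ev (a / numeral n) = ev a / numeral n"
proof -
  have inv: "inverse (numeral n) \<in> laurent_ring" "ev (inverse (numeral n)) = inverse (numeral n)"
    using laurent_ring_gens(5)[of "inverse (numeral n)"] ev_gens(3)[of "inverse (numeral n)"]
    unfolding kqt.emb_inverse_numeral emb_inverse_numeral .
  show "a / numeral n \<in> laurent_ring" "ev (a / numeral n) = ev a / numeral n"
    unfolding divide_inverse ev_mult[OF assms inv(1)] inv(2)
    by (rule R_mult[OF assms inv(1)] refl)+
qed

lemmas laurent_ring_intros = R_0 R_1 R_add R_diff R_mult R_power R_numeral divide_numeral(1)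
  laurent_ring_powi(1,3) laurent_ring_gens

lemmas ev_simps = laurent_ring_intros ev_0 ev_1 ev_add ev_diff ev_mult ev_power ev_numeral divide_numeral(2)
  laurent_ring_powi ev_gens

text \<open>
  At \<open>q = 1\<close> the parameter \<open>\<theta>\<close> becomes the parameter \<open>\<kappa>\<close> of the commutative algebras.
\<close>

lemma theta_laurent_ring: "theta \<in> laurent_ring" and ev_theta: "ev theta = y powi 2 + y powi - 2"
  using y_nonzero by (simp_all add: theta_def ev_simps)
    (simp add: power_int_def field_simps flip: power_add)

end

interpretation kt: laurent_point const_kt s4
proof
  have "s4 = to_fract [:0, 1:]"
    by (simp add: s4_def to_fract_def)
  moreover have "to_fract [:0, 1:] \<noteq> (0 :: kt)"
    unfolding to_fract_eq_0_iff by simp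
  ultimately show "s4 \<noteq> 0"
    by (rule ssubst)
qed (simp_all add: const_kt_eq_to_fract pCons_one flip: to_fract_add to_fract_mult)

interpretation complex: laurent_point id "1 :: complex"
  by standard simp_all

section \<open>Integral forms and their reduction\<close>

lemma poly_mapping_eq_sum_single:
  "p = (\<Sum>k\<in>Poly_Mapping.keys p. Poly_Mapping.single k (Poly_Mapping.lookup p k))"
proof (rule poly_mapping_eqI)
  fix k
  have "Poly_Mapping.lookup
      (\<Sum>k\<in>Poly_Mapping.keys p. Poly_Mapping.single k (Poly_Mapping.lookup p k)) k
      = (\<Sum>j\<in>Poly_Mapping.keys p. if j = k then Poly_Mapping.lookup p j else 0)"
    by (simp add: lookup_sum lookup_single when_def)
  then show "Poly_Mapping.lookup p k = Poly_Mapping.lookup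
      (\<Sum>k\<in>Poly_Mapping.keys p. Poly_Mapping.single k (Poly_Mapping.lookup p k)) k"
    by (simp add: in_keys_iff)
qed

text \<open>
  Writing normally ordered monomials as products over words turns questions about reordering
  into questions about permutations of lists.
\<close>

definition normal_word :: "gen multiset \<Rightarrow> gen list" where
  "normal_word n = concat (map (\<lambda>g. replicate (count n g) g)
    [O1, O2, O3, O4, O5, O6, O12, O23, O34, O45, O56, O61, O123, O234, O345])"

lemma mset_normal_word: "mset (normal_word n) = n"
proof (rule multiset_eqI)
  fix g
  show "count (mset (normal_word n)) g = count n g"
    by (cases g) (simp_all add: normal_word_def)
qed

lemma monomial_eq_prod_list: "monomial x n = prod_list (map x (normal_word n))"
  by (simp add: monomial_def normal_word_def mult.assoc)

lemma small_in_B: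
  assumes "size n \<le> 1"
  shows "n \<in> B"
proof -
  have large: "\<forall>m\<in>forbidden. 1 < size m"
    by (simp add: forbidden_def)
  have "\<not> m \<subseteq># n" if "m \<in> forbidden" for m
  proof
    assume "m \<subseteq># n"
    from size_mset_mono[OF this] assms bspec[OF large that] show False
      by linarith
  qed
  then show ?thesis
    unfolding B_def by blast
qed

locale basis_algebra = vector_space sc
  for sc :: "'k::field \<Rightarrow> 'a::{ring, monoid_mult} \<Rightarrow> 'a" +
  fixes x :: "gen \<Rightarrow> 'a"
  assumes basis: "B_is_basis sc x"
begin

abbreviation "mon \<equiv> monomial x"

text \<open>
  Outside \<open>B\<close> the coordinate is set to zero: \<open>mon b\<close> could coincide there with a basis element.
\<close>

definition coord :: "'a \<Rightarrow> gen multiset \<Rightarrow> 'k" where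
  "coord a b = (if b \<in> B then representation (mon ` B) a (mon b) else 0)"

lemma inj_mon: "inj_on mon B" and independent_mon: "independent (mon ` B)"
  and in_span_mon: "a \<in> span (mon ` B)"
  using basis by (auto simp: B_is_basis_def)

lemma coord_add: "coord (a + a') b = coord a b + coord a' b"
  and coord_diff: "coord (a - a') b = coord a b - coord a' b"
  and coord_uminus: "coord (- a) b = - coord a b"
  and coord_scale: "coord (sc c a) b = c * coord a b"
  by (simp_all add: coord_def representation_add representation_diff representation_neg representation_scale
      independent_mon in_span_mon)

lemma coord_0: "coord 0 b = 0"
  using coord_scale[of 0 0 b] by simp

lemma coord_sum: "coord (sum f I) b = (\<Sum>i\<in>I. coord (f i) b)"
  by (induction I rule: infinite_finite_induct) (simp_all add: coord_0 coord_add)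

lemma coord_mon: "b \<in> B \<Longrightarrow> coord (mon b) c = (if c = b then 1 else 0)"
  using inj_mon by (auto simp: coord_def representation_basis independent_mon inj_on_eq_iff)

definition support :: "'a \<Rightarrow> gen multiset set" where
  "support a = {b. coord a b \<noteq> 0}"

lemma support_subset: "support a \<subseteq> B"
  by (auto simp: support_def coord_def)

lemma finite_support: "finite (support a)"
proof (rule finite_imageD)
  show "inj_on mon (support a)"
    using inj_mon support_subset by (rule inj_on_subset)
  have "mon ` support a \<subseteq> {v. representation (mon ` B) a v \<noteq> 0}"
    by (auto simp: support_def coord_def split: if_splits)
  then show "finite (mon ` support a)"
    using finite_representation finite_subset by blast
qed

lemma expansion: "a = (\<Sum>b\<in>support a. sc (coord a b) (mon b))"
proof -
  have *: "{v. representation (mon ` B) a v \<noteq> 0} = mon ` support a"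
  proof -
    have "v \<in> mon ` B" if "representation (mon ` B) a v \<noteq> 0" for v
      using representation_ne_zero[OF that] .
    then show ?thesis
      by (auto simp: support_def coord_def)
  qed
  have "inj_on mon (support a)"
    using inj_mon support_subset by (rule inj_on_subset)
  then have "(\<Sum>b\<in>support a. sc (representation (mon ` B) a (mon b)) (mon b)) = a"
    using sum_nonzero_representation_eq[OF independent_mon in_span_mon[of a]]
    by (simp add: * sum.reindex)
  moreover have "coord a b = representation (mon ` B) a (mon b)" if "b \<in> support a" for b
    using that support_subset by (auto simp: coord_def)
  ultimately show ?thesis
    by simp
qed

lemma coord_mult_mon: "b3 \<in> B \<Longrightarrow> coord (mon b1 * mon b2) b3 = struct_const sc x b1 b2 b3"
  by (simp add: coord_def struct_const_def)

lemma mon_empty: "mon {#} = 1"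
  by (simp add: monomial_def)

lemma mon_single: "mon {#g#} = x g"
  by (cases g) (simp_all add: monomial_def)

end

text \<open>
  An algebra with basis \<open>B\<close> whose structure constants lie in a subring \<open>R\<close> of the ground field,
  together with a homomorphism \<open>ev\<close> from \<open>R\<close> to another field.
\<close>

locale integral_form = basis_algebra sc x + ring_specialization R ev
  for sc :: "'k::field \<Rightarrow> 'a::{ring, monoid_mult} \<Rightarrow> 'a" and x :: "gen \<Rightarrow> 'a"
    and R :: "'k set" and ev :: "'k \<Rightarrow> 'l::field" +
  assumes scale_mult_left: "sc c a * b = sc c (a * b)"
    and scale_mult_right: "a * sc c b = sc c (a * b)"
    and structure_integral: "b1 \<in> B \<Longrightarrow> b2 \<in> B \<Longrightarrow> b3 \<in> B \<Longrightarrow> struct_const sc x b1 b2 b3 \<in> R"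
begin

text \<open>
  The \<open>R\<close>-span of the basis, and the coordinates of an element after applying \<open>ev\<close>. The map \<open>red\<close> is
  meaningful on \<open>L\<close> only. Two elements of \<open>L\<close> with the same reduced coordinates are identified in
  the reduction.
\<close>

definition L :: "'a set" where
  "L = {a. \<forall>b. coord a b \<in> R}"

definition red :: "'a \<Rightarrow> gen multiset \<Rightarrow> 'l" where
  "red a b = ev (coord a b)"

lemma L_coord: "a \<in> L \<Longrightarrow> coord a b \<in> R"
  by (simp add: L_def)

lemma L_add: "a \<in> L \<Longrightarrow> a' \<in> L \<Longrightarrow> a + a' \<in> L"
  and L_diff: "a \<in> L \<Longrightarrow> a' \<in> L \<Longrightarrow> a - a' \<in> L"
  and L_uminus: "a \<in> L \<Longrightarrow> - a \<in> L"
  and L_scale: "c \<in> R \<Longrightarrow> a \<in> L \<Longrightarrow> sc c a \<in> L"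
  by (simp_all add: L_def coord_add coord_diff coord_uminus coord_scale R_add R_diff R_uminus R_mult)

lemma L_sum: "(\<And>i. i \<in> I \<Longrightarrow> f i \<in> L) \<Longrightarrow> sum f I \<in> L"
  by (simp add: L_def coord_sum R_sum)

lemma red_add: "a \<in> L \<Longrightarrow> a' \<in> L \<Longrightarrow> red (a + a') b = red a b + red a' b"
  and red_diff: "a \<in> L \<Longrightarrow> a' \<in> L \<Longrightarrow> red (a - a') b = red a b - red a' b"
  and red_uminus: "a \<in> L \<Longrightarrow> red (- a) b = - red a b"
  and red_scale: "c \<in> R \<Longrightarrow> a \<in> L \<Longrightarrow> red (sc c a) b = ev c * red a b"
  by (simp_all add: red_def L_coord coord_add coord_diff coord_uminus coord_scale ev_add ev_diff
      ev_uminus ev_mult)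

lemma red_sum: "(\<And>i. i \<in> I \<Longrightarrow> f i \<in> L) \<Longrightarrow> red (sum f I) b = (\<Sum>i\<in>I. red (f i) b)"
  by (simp add: red_def coord_sum ev_sum L_coord)

lemma L_mon: "b \<in> B \<Longrightarrow> mon b \<in> L"
  by (simp add: L_def coord_mon R_0 R_1)

lemma red_mon: "b \<in> B \<Longrightarrow> red (mon b) c = (if c = b then 1 else 0)"
  by (simp add: red_def coord_mon ev_0 ev_1)

lemma L_1: "1 \<in> L" and L_x: "x g \<in> L"
  using L_mon[of "{#}"] L_mon[of "{#g#}"] by (simp_all add: small_in_B mon_empty mon_single)

lemma coord_mult:
  "coord (a * a') c = (\<Sum>b\<in>support a. \<Sum>b'\<in>support a'.
    coord a b * coord a' b' * coord (mon b * mon b') c)"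
proof -
  have "a * a' = (\<Sum>b\<in>support a. \<Sum>b'\<in>support a'. sc (coord a b * coord a' b') (mon b * mon b'))"
    by (subst (1) expansion[of a], subst (1) expansion[of a'])
      (simp only: sum_product scale_mult_left scale_mult_right scale_scale mult.commute)
  then show ?thesis
    by (simp add: coord_sum coord_scale)
qed

lemma coord_mult_mon_integral: "b \<in> support a \<Longrightarrow> b' \<in> support a' \<Longrightarrow> coord (mon b * mon b') c \<in> R"
proof -
  assume "b \<in> support a" "b' \<in> support a'"
  then have "b \<in> B" "b' \<in> B"
    using support_subset by auto
  then show ?thesis
    by (cases "c \<in> B") (simp add: coord_mult_mon structure_integral, simp add: coord_def R_0)
qed

lemma L_mult:
  assumes "a \<in> L" "a' \<in> L"
  shows "a * a' \<in> L"
proof -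
  note integral_products = coord_mult_mon_integral[of _ a _ a']
  have "coord (a * a') c \<in> R" for c
    unfolding coord_mult[of a a' c] by (intro R_sum R_mult) (simp_all add: integral_products L_coord assms)
  then show ?thesis
    by (simp add: L_def)
qed

text \<open>
  The elements of \<open>L\<close> with vanishing reduction form an ideal: each coordinate of a product is a
  sum of terms which contain one coordinate of either factor and a structure constant from \<open>R\<close>.
\<close>

lemma red_mult_eq_0:
  assumes "a \<in> L" "a' \<in> L" "(\<forall>b. red a b = 0) \<or> (\<forall>b. red a' b = 0)"
  shows "red (a * a') c = 0"
proof -
  note integral_products = coord_mult_mon_integral[of _ a _ a']
  have "red (a * a') c = (\<Sum>b\<in>support a. \<Sum>b'\<in>support a'.
      red a b * red a' b' * ev (coord (mon b * mon b') c))"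
    unfolding red_def coord_mult[of a a' c]
    by (simp add: ev_sum ev_mult R_mult R_sum integral_products L_coord assms(1,2))
  also have "\<dots> = 0"
    using assms(3) by auto
  finally show ?thesis .
qed

definition cong :: "'a \<Rightarrow> 'a \<Rightarrow> bool" where
  "cong a a' \<longleftrightarrow> a \<in> L \<and> a' \<in> L \<and> red a = red a'"

lemma cong_refl: "a \<in> L \<Longrightarrow> cong a a"
  and cong_sym: "cong a a' \<Longrightarrow> cong a' a"
  and cong_trans [trans]: "cong a a' \<Longrightarrow> cong a' a'' \<Longrightarrow> cong a a''"
  by (simp_all add: cong_def)

lemma cong_mult:
  assumes "cong a b" "cong a' b'"
  shows "cong (a * a') (b * b')"
proof -
  have L: "a \<in> L" "b \<in> L" "a' \<in> L" "b' \<in> L" and eq: "red a = red b" "red a' = red b'"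
    using assms by (auto simp: cong_def)
  have "red (a * a') c = red (b * b') c" for c
  proof -
    have "a * a' = b * b' + (a - b) * a' + b * (a' - b')"
      by (simp add: algebra_simps)
    then have "red (a * a') c = red (b * b') c + red ((a - b) * a') c + red (b * (a' - b')) c"
      using L by (simp add: red_add L_add L_mult L_diff)
    moreover have "red ((a - b) * a') c = 0" "red (b * (a' - b')) c = 0"
      using L eq by (auto intro!: red_mult_eq_0 L_diff simp: red_diff)
    ultimately show ?thesis
      by simp
  qed
  then show ?thesis
    using L by (auto simp: cong_def L_mult)
qed

end

text \<open>
  If the generators commute after reduction, evaluating commutative polynomials at the generators
  makes sense. The target is never built as a type: reduced coordinates of elements of \<open>L\<close> serve
  as its elements.
\<close>

locale commutative_reduction = integral_form sc x R ev
  for sc :: "'k::field \<Rightarrow> 'a::{ring, monoid_mult} \<Rightarrow> 'a" and x :: "gen \<Rightarrow> 'a"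
    and R :: "'k set" and ev :: "'k \<Rightarrow> 'l::field" +
  assumes x_commute: "red (x g * x h) = red (x h * x g)"
begin

abbreviation word :: "gen list \<Rightarrow> 'a" where
  "word w \<equiv> prod_list (map x w)"

lemma L_word: "word w \<in> L"
  by (induction w) (simp_all add: L_1 L_mult L_x)

lemma L_monomial: "mon n \<in> L"
  unfolding monomial_eq_prod_list by (rule L_word)

lemma cong_word_move: "cong (word w * x g) (x g * word w)"
proof (induction w)
  case Nil
  show ?case by (simp add: cong_refl L_x)
next
  case (Cons h w)
  have "cong (x h * (word w * x g)) (x h * (x g * word w))"
    by (intro cong_mult Cons.IH cong_refl L_x)
  moreover have "cong ((x h * x g) * word w) ((x g * x h) * word w)"
    by (rule cong_mult[OF _ cong_refl[OF L_word]]) (simp add: cong_def L_mult L_x x_commute)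
  ultimately show ?case
    using cong_trans by (simp add: mult.assoc)
qed

lemma cong_word_permute: "mset v = mset w \<Longrightarrow> cong (word v) (word w)"
proof (induction v arbitrary: w)
  case Nil
  then show ?case by (simp add: cong_refl L_1)
next
  case (Cons g v)
  then have "g \<in> set w"
    by (metis list.set_intros(1) set_mset_mset)
  then obtain w1 w2 where w: "w = w1 @ g # w2"
    by (auto dest: split_list)
  have "cong (word (g # v)) (x g * word (w1 @ w2))"
    using cong_mult[OF cong_refl[OF L_x] Cons.IH[of "w1 @ w2"]] Cons.prems w by simp
  also have "cong (x g * word (w1 @ w2)) (word w)"
    using cong_mult[OF cong_sym[OF cong_word_move] cong_refl[OF L_word], of g w1 w2]
    by (simp add: w mult.assoc)
  finally show ?case .
qed

text \<open>
  Up to reduction, normal ordering has no effect, so products of normally ordered monomials are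
  computed by adding exponents, as in the polynomial algebra.
\<close>

lemma cong_monomial_add: "cong (mon (n + m)) (mon n * mon m)"
  using cong_word_permute[of "normal_word (n + m)" "normal_word n @ normal_word m"]
  by (simp add: monomial_eq_prod_list mset_normal_word)

text \<open>
  The homomorphism from the polynomial algebra to the reduction, in coordinates: a commutative monomial
  goes to the reduction of the normally ordered monomial with the same exponents.
\<close>

definition reduce :: "'l poly_alg \<Rightarrow> gen multiset \<Rightarrow> 'l" where
  "reduce p b = (\<Sum>n\<in>Poly_Mapping.keys p. Poly_Mapping.lookup p n * red (mon n) b)"

lemma reduce_superset: "finite A \<Longrightarrow> Poly_Mapping.keys p \<subseteq> A \<Longrightarrow>
    reduce p b = (\<Sum>n\<in>A. Poly_Mapping.lookup p n * red (mon n) b)"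
  unfolding reduce_def by (rule sum.mono_neutral_left) (auto simp: in_keys_iff)

lemma reduce_add: "reduce (p + r) b = reduce p b + reduce r b"
proof -
  let ?A = "Poly_Mapping.keys p \<union> Poly_Mapping.keys r"
  show ?thesis
    using reduce_superset[of ?A "p + r" b] reduce_superset[of ?A p b] reduce_superset[of ?A r b]
      Poly_Mapping.keys_add[of p r]
    by (simp add: lookup_add distrib_right sum.distrib)
qed

lemma reduce_0: "reduce 0 b = 0"
  by (simp add: reduce_def)

lemma reduce_sum: "reduce (sum f I) b = (\<Sum>i\<in>I. reduce (f i) b)"
  by (induction I rule: infinite_finite_induct) (simp_all add: reduce_0 reduce_add)

lemma reduce_single: "reduce (Poly_Mapping.single n c) b = c * red (mon n) b"
  by (cases "c = 0") (simp_all add: reduce_def)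

lemma reduce_scale: "reduce (c \<bullet> p) b = c * reduce p b"
proof -
  have "c \<bullet> p = (\<Sum>n\<in>Poly_Mapping.keys p. Poly_Mapping.single n (c * Poly_Mapping.lookup p n))"
    unfolding scale_free_def
    by (subst (1) poly_mapping_eq_sum_single[of p]) (simp add: sum_distrib_left mult_single)
  then show ?thesis
    by (simp add: reduce_sum reduce_single) (simp add: reduce_def sum_distrib_left mult.assoc)
qed

text \<open>
  The kernel of \<open>reduce\<close>. The quantifier over \<open>n\<close> builds closure under multiplication by monomials
  into the definition, so that it is an ideal without any product being defined on coordinates.
\<close>

definition vanishing :: "'l poly_alg set" where
  "vanishing = {p. \<forall>n b. reduce (Poly_Mapping.single n 1 * p) b = 0}"

lemma vanishing_mult: "p \<in> vanishing \<Longrightarrow> r * p \<in> vanishing"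
proof -
  assume p: "p \<in> vanishing"
  have "reduce (Poly_Mapping.single n 1 * (r * p)) b = 0" for n b
  proof -
    have "Poly_Mapping.single n 1 * (r * p) = (\<Sum>m\<in>Poly_Mapping.keys r.
        Poly_Mapping.lookup r m \<bullet> (Poly_Mapping.single (n + m) 1 * p))"
      unfolding scale_free_def
      by (subst (1) poly_mapping_eq_sum_single[of r])
        (simp add: sum_distrib_left sum_distrib_right mult_single flip: mult.assoc)
    then show ?thesis
      using p by (simp add: reduce_sum reduce_scale vanishing_def)
  qed
  then show ?thesis
    by (simp add: vanishing_def)
qed

lemma ideal_vanishing:
  assumes "rels \<subseteq> vanishing" "p \<in> two_sided_ideal rels"
  shows "p \<in> vanishing"
  using assms(2)
proof induction
  case (base p)
  then show ?case using assms(1) by auto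
next
  case zero
  show ?case by (simp add: vanishing_def reduce_0)
next
  case (add p r)
  then show ?case by (simp add: vanishing_def distrib_left reduce_add)
next
  case (mult_left p r)
  then show ?case by (simp add: vanishing_mult)
next
  case (mult_right p r)
  then show ?case by (simp add: vanishing_mult mult.commute[of p])
qed

text \<open>
  Multiplication by \<open>a\<close> has the same effect on reduced monomials as multiplication by the
  polynomial \<open>p\<close>. The closure properties below cover the way in which the relations are built from the generators, so
  that \<open>p\<close> vanishes in the reduction as soon as some lift of it does.
\<close>

definition lifts :: "'l poly_alg \<Rightarrow> 'a \<Rightarrow> bool" where
  "lifts p a \<longleftrightarrow> a \<in> L \<and> (\<forall>n. reduce (Poly_Mapping.single n 1 * p) = red (mon n * a))"

lemma lifts_1: "lifts 1 1"
  by (auto simp: lifts_def L_1 reduce_single)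

lemma lifts_add: "lifts p a \<Longrightarrow> lifts r b \<Longrightarrow> lifts (p + r) (a + b)"
  by (auto simp: lifts_def L_add L_mult L_monomial distrib_left reduce_add red_add)

lemma lifts_scale: "lifts p a \<Longrightarrow> c \<in> R \<Longrightarrow> lifts (ev c \<bullet> p) (sc c a)"
proof -
  assume p: "lifts p a" and c: "c \<in> R"
  have "Poly_Mapping.single n 1 * (ev c \<bullet> p) = ev c \<bullet> (Poly_Mapping.single n 1 * p)" for n
    by (simp add: scale_free_def mult.left_commute)
  then show ?thesis
    using p c by (auto simp: lifts_def L_scale scale_mult_right red_scale L_mult L_monomial reduce_scale)
qed

lemma lifts_gen_mult: "lifts p a \<Longrightarrow> lifts (poly_gen g * p) (x g * a)"
proof -
  assume p: "lifts p a"
  have "reduce (Poly_Mapping.single n 1 * (poly_gen g * p)) = red (mon n * (x g * a))" for n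
  proof -
    have "reduce (Poly_Mapping.single n 1 * (poly_gen g * p)) = red (mon (n + {#g#}) * a)"
      using p by (simp add: lifts_def poly_gen_def mult_single flip: mult.assoc)
    also have "\<dots> = red (mon n * x g * a)"
      using cong_mult[OF cong_monomial_add[of n "{#g#}"] cong_refl, of a] p
      by (simp add: lifts_def cong_def mon_single)
    finally show ?thesis
      by (simp add: mult.assoc)
  qed
  then show ?thesis
    using p by (simp add: lifts_def L_mult L_x)
qed

lemma lifts_gen: "lifts (poly_gen g) (x g)"
  using lifts_gen_mult[OF lifts_1] by simp

lemma lifts_uminus: "lifts p a \<Longrightarrow> lifts (- p) (- a)"
  using lifts_scale[OF _ R_uminus[OF R_1], of p a]
  by (simp add: ev_uminus R_1 ev_1 scale_free_def single_uminus)

lemma lifts_diff: "lifts p a \<Longrightarrow> lifts r b \<Longrightarrow> lifts (p - r) (a - b)"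
  using lifts_add[OF _ lifts_uminus, of p a r b] by simp

lemma lifts_sum: "(\<And>i. i \<in> I \<Longrightarrow> lifts (f i) (h i)) \<Longrightarrow> lifts (sum f I) (sum h I)"
  using lifts_diff[OF lifts_1 lifts_1]
  by (induction I rule: infinite_finite_induct) (simp_all add: lifts_add)

lemma vanishing_if_lifts: "lifts p a \<Longrightarrow> (\<And>b. red a b = 0) \<Longrightarrow> p \<in> vanishing"
  by (auto simp: lifts_def vanishing_def L_monomial intro!: red_mult_eq_0)

text \<open>
  The comparison of structure constants. In the quotient by \<open>rels\<close>, the product of two monomials
  \<open>b1\<close>, \<open>b2\<close> is the monomial \<open>b1 + b2\<close>, and also its expansion in the basis \<open>B\<close>. The difference of these
  polynomials lies in the ideal, so \<open>reduce\<close> takes them to the same coordinates; on the basis monomials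
  \<open>reduce\<close> just reads off coefficients, which leaves the structure constants of the quotient on one
  side and the reduced product of \<open>b1\<close> and \<open>b2\<close> on the other.
\<close>

lemma reduced_struct_const:
  fixes proj :: "'l poly_alg \<Rightarrow> 'e::{ring, monoid_mult}"
  assumes basis': "basis_algebra sc' (\<lambda>g. proj (poly_gen g))"
    and proj: "\<And>p r. proj p = proj r \<longleftrightarrow> p - r \<in> two_sided_ideal rels"
      "\<And>p r. proj (p + r) = proj p + proj r" "\<And>p r. proj (p * r) = proj p * proj r" "proj 1 = 1"
      "\<And>c p. proj (c \<bullet> p) = sc' c (proj p)"
    and rels: "rels \<subseteq> vanishing"
    and B: "b1 \<in> B" "b2 \<in> B" "b3 \<in> B"
  shows "struct_const sc' (\<lambda>g. proj (poly_gen g)) b1 b2 b3 = ev (struct_const sc x b1 b2 b3)"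
proof -
  interpret t: basis_algebra sc' "\<lambda>g. proj (poly_gen g)"
    by (rule basis')
  have "prod_list (map (\<lambda>g. proj (poly_gen g)) w) = proj (Poly_Mapping.single (mset w) 1)" for w
    by (induction w) (simp_all add: proj(4) poly_gen_def mult_single flip: proj(3))
  then have mon: "t.mon n = proj (Poly_Mapping.single n 1)" for n
    by (simp add: monomial_eq_prod_list mset_normal_word)
  have proj_0: "proj 0 = 0"
    using proj(2)[of 0 0] by simp
  have proj_sum: "proj (sum f I) = (\<Sum>i\<in>I. proj (f i))" for f :: "gen multiset \<Rightarrow> 'l poly_alg" and I
    by (induction I rule: infinite_finite_induct) (simp_all add: proj_0 proj(2))
  let ?a = "t.mon b1 * t.mon b2"
  let ?p = "\<Sum>b\<in>t.support ?a. Poly_Mapping.single b (t.coord ?a b)"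
  have "proj ?p = (\<Sum>b\<in>t.support ?a. sc' (t.coord ?a b) (t.mon b))"
    by (simp add: proj_sum mon scale_free_def mult_single flip: proj(5))
  also have "\<dots> = ?a"
    by (rule t.expansion[symmetric])
  also have "\<dots> = proj (Poly_Mapping.single (b1 + b2) 1)"
    by (simp add: mon mult_single flip: proj(3))
  finally have "?p - Poly_Mapping.single (b1 + b2) 1 \<in> vanishing"
    using ideal_vanishing[OF rels] proj(1) by blast
  moreover have "reduce ?p b = reduce (Poly_Mapping.single (b1 + b2) 1) b"
    if "?p - Poly_Mapping.single (b1 + b2) 1 \<in> vanishing" for b
  proof -
    have "reduce (?p - Poly_Mapping.single (b1 + b2) 1) b = 0"
      using that by (auto simp: vanishing_def dest: spec[of _ 0])
    then show ?thesis
      using reduce_add[of "?p - Poly_Mapping.single (b1 + b2) 1" "Poly_Mapping.single (b1 + b2) 1" b]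
      by simp
  qed
  ultimately have "reduce ?p b3 = reduce (Poly_Mapping.single (b1 + b2) 1) b3"
    by blast
  moreover have "reduce ?p b3 = (\<Sum>b\<in>t.support ?a. t.coord ?a b * red (mon b) b3)"
    by (simp add: reduce_sum reduce_single)
  moreover have "\<dots> = (\<Sum>b\<in>t.support ?a. if b3 = b then t.coord ?a b else 0)"
  proof (rule sum.cong)
    fix b assume "b \<in> t.support ?a"
    then have "b \<in> B"
      using t.support_subset by blast
    then show "t.coord ?a b * red (mon b) b3 = (if b3 = b then t.coord ?a b else 0)"
      by (simp add: red_mon)
  qed simp
  moreover have "\<dots> = t.coord ?a b3"
    using t.finite_support by (simp add: t.support_def)
  moreover have "reduce (Poly_Mapping.single (b1 + b2) 1) b3 = ev (coord (mon b1 * mon b2) b3)"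
    using cong_monomial_add[of b1 b2] by (simp add: reduce_single cong_def red_def)
  ultimately show ?thesis
    using B by (simp add: t.coord_mult_mon coord_mult_mon)
qed

end

section \<open>Products from \<open>q\<close>-commutators\<close>

locale q_algebra = vector_space sc
  for sc :: "'k::field \<Rightarrow> 'a::{ring, monoid_mult} \<Rightarrow> 'a" +
  fixes q :: 'k
  assumes scale_mult_left: "sc c a * b = sc c (a * b)"
    and scale_mult_right: "a * sc c b = sc c (a * b)"
    and q_nonzero: "q \<noteq> 0"
    and q_generic: "q powi 2 \<noteq> q powi (-2)"
begin

text \<open>
  Here \<open>q\<close> stands for \<open>q\<^sup>1\<^sup>/\<^sup>4\<close>. Powers of it are treated as operators \<open>T k\<close>, so that all identities below
  are identities between sums of terms \<open>T k w\<close> with words \<open>w\<close>, which rewriting can normalize. The operator \<open>lam\<close> multiplies by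
  \<open>q\<^sup>1\<^sup>/\<^sup>2 - q\<^sup>-\<^sup>1\<^sup>/\<^sup>2\<close>, and \<open>q_bracket j a b c\<close> is the relation \<open>[a, b] = c\<close> for the bracket with index \<open>q\<^sup>j\<close>, with
  the denominator cleared.
\<close>

definition T :: "int \<Rightarrow> 'a \<Rightarrow> 'a" where
  "T k a = sc (q powi k) a"

definition lam :: "'a \<Rightarrow> 'a" where
  "lam a = T 2 a - T (-2) a"

definition q_bracket :: "int \<Rightarrow> 'a \<Rightarrow> 'a \<Rightarrow> 'a \<Rightarrow> bool" where
  "q_bracket j a b c \<longleftrightarrow> T j (a * b) - T (- j) (b * a) = lam c"

lemma T_add: "T k (a + b) = T k a + T k b"
  and T_diff: "T k (a - b) = T k a - T k b"
  and T_minus: "T k (- a) = - T k a"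
  and T_scale: "T k (sc c a) = sc c (T k a)"
  and T_mult_left: "T k a * b = T k (a * b)"
  and T_mult_right: "a * T k b = T k (a * b)"
  and T_T: "T k (T l a) = T (k + l) a"
  and T_0: "T 0 a = a"
  by (simp_all add: T_def scale_right_distrib scale_right_diff_distrib scale_mult_left
      scale_mult_right power_int_add q_nonzero mult.commute)

lemmas T_simps = T_add T_diff T_minus T_mult_left T_mult_right T_T T_0 T_scale
  scale_mult_left scale_mult_right scale_right_distrib scale_right_diff_distrib

lemma lam_eq_scale: "lam a = sc (q powi 2 - q powi (-2)) a"
  by (simp add: lam_def T_def scale_left_diff_distrib)

lemma lam_cancel: "lam a = lam b \<longleftrightarrow> a = b"
  using q_generic by (simp add: lam_eq_scale)

text \<open>
  A bracket relation as a rule for moving one letter past another, also inside a longer word.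
\<close>

lemma q_bracket_swap:
  assumes "q_bracket j a b c"
  shows "b * a = T (2 * j) (a * b) - T j (lam c)"
    and "b * (a * d) = T (2 * j) (a * (b * d)) - T j (lam c * d)"
proof -
  have "T j (T (- j) (b * a)) = T j (T j (a * b) - lam c)"
    using assms by (simp add: q_bracket_def algebra_simps)
  then show *: "b * a = T (2 * j) (a * b) - T j (lam c)"
    by (simp add: T_simps)
  show "b * (a * d) = T (2 * j) (a * (b * d)) - T j (lam c * d)"
    unfolding mult.assoc[symmetric] * by (simp add: T_simps algebra_simps)
qed

lemma q_bracket_swap_back:
  assumes "q_bracket j a b c"
  shows "a * b = T (- 2 * j) (b * a) + T (- j) (lam c)"
    and "a * (b * d) = T (- 2 * j) (b * (a * d)) + T (- j) (lam c * d)"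
proof -
  have "T (- j) (T j (a * b)) = T (- j) (T (- j) (b * a) + lam c)"
    using assms by (simp add: q_bracket_def algebra_simps)
  then show *: "a * b = T (- 2 * j) (b * a) + T (- j) (lam c)"
    by (simp add: T_simps)
  show "a * (b * d) = T (- 2 * j) (b * (a * d)) + T (- j) (lam c * d)"
    unfolding mult.assoc[symmetric] * by (simp add: T_simps algebra_simps)
qed

lemma commute_assoc: "a * b = b * a \<Longrightarrow> a * (b * c) = b * (a * (c::'a))"
  by (simp add: mult.assoc[symmetric])

text \<open>
  The names of the variables indicate how the lemmas are used: \<open>a\<close>, \<open>b\<close>, \<open>c\<close> are three
  successive single generators, and concatenated names stand for the generators with the
  concatenated indices. The commutator of \<open>bc\<close> and \<open>ab\<close> is computed by expanding \<open>ab\<close> in \<open>a\<close> and \<open>b\<close> and moving these past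
  \<open>bc\<close>. Every term of the result carries two factors \<open>lam\<close>, one of which cancels.
\<close>

lemma commutator_of_overlapping_doubles:
  assumes ab: "q_bracket 1 a b ab" and abc: "q_bracket 1 a bc abc" and c: "q_bracket 1 bc b c"
    and comm: "abc * b = b * abc" "c * a = a * c"
  shows "bc * ab - ab * bc = lam (a * c - b * abc)"
proof -
  note swap = q_bracket_swap[OF abc] q_bracket_swap_back[OF c] comm
  have e: "lam ab = T 1 (a * b) - T (-1) (b * a)"
    using ab by (simp add: q_bracket_def)
  have "lam (bc * ab - ab * bc) = bc * lam ab - lam ab * bc"
    by (simp add: lam_def T_simps algebra_simps)
  also have "\<dots> = lam (lam (a * c - b * abc))"
    unfolding e by (simp add: lam_def T_simps algebra_simps swap)
  finally show ?thesis
    by (simp add: lam_cancel)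
qed

text \<open>
  The bracket with index \<open>q\<^sup>2\<close> of the same two generators is a defining relation. Once the
  commutator is substituted into it, \<open>lam (ab * bc)\<close> is the only term left with a product of double
  generators, so \<open>lam\<close> cancels and determines that product.
\<close>

lemma product_of_overlapping_doubles:
  assumes ab: "q_bracket 1 a b ab" and abc: "q_bracket 1 a bc abc" and c: "q_bracket 1 bc b c"
    and comm: "abc * b = b * abc" "c * a = a * c"
    and d: "q_bracket 2 bc ab (T 2 (a * c) + T (-2) (a * c) - sc th d)"
  shows "ab * bc = T 2 (b * abc) + T (-2) (a * c) - sc th d"
proof -
  have e: "bc * ab = ab * bc + lam (a * c - b * abc)"
    using commutator_of_overlapping_doubles[OF ab abc c comm] by (simp add: algebra_simps)
  have "lam (ab * bc) = lam (T 2 (b * abc) + T (-2) (a * c) - sc th d)"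
    using d unfolding q_bracket_def e by (simp add: lam_def T_simps algebra_simps)
  then show ?thesis
    by (simp add: lam_cancel)
qed

text \<open>
  The previous identity is \<open>q\<close>-commuted with the generator \<open>z\<close> preceding \<open>a\<close>. On the left-hand side \<open>z\<close>
  only interacts with \<open>ab\<close>, and each term acquires a factor \<open>lam\<close>. The generator \<open>d\<close> precedes \<open>z\<close> and so
  brackets with it in the opposite order; weighting with \<open>T 2\<close> in front of \<open>z * _\<close> leaves a factor \<open>lam\<close> there, too.
\<close>

lemma product_of_triple_and_double:
  assumes product: "ab * bc = T 2 (b * abc) + T (-2) (a * c) - sc th d"
    and br: "q_bracket 1 z ab zab" "q_bracket 1 z abc zabc" "q_bracket 1 z a za" "q_bracket 1 d z dz"
    and comm: "bc * z = z * bc" "b * z = z * b" "c * z = z * c"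
  shows "zab * bc = T 2 (b * zabc) + T (-2) (za * c) - sc th (T (-1) (z * d) - T (-2) dz)"
proof -
  note swap = br(1-3)[THEN q_bracket_swap(1)] br(1-3)[THEN q_bracket_swap(2)]
    q_bracket_swap_back[OF br(4)]
    comm comm[THEN commute_assoc]
  have "lam (T 1 (zab * bc)) = T 2 (z * (ab * bc)) - (ab * bc) * z"
    by (simp add: lam_def T_simps algebra_simps swap)
  also have "\<dots> = lam (T 1 (T 2 (b * zabc) + T (-2) (za * c) - sc th (T (-1) (z * d) - T (-2) dz)))"
    unfolding product by (simp add: lam_def T_simps algebra_simps swap)
  finally have "T (-1) (T 1 (zab * bc)) =
      T (-1) (T 1 (T 2 (b * zabc) + T (-2) (za * c) - sc th (T (-1) (z * d) - T (-2) dz)))"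
    by (simp only: lam_cancel)
  then show ?thesis
    by (simp only: T_T) (simp add: T_0)
qed

text \<open>
  Another \<open>q\<close>-commutator, with the generator \<open>w\<close> that follows \<open>c\<close> and precedes \<open>d\<close> in the cyclic order.
  Hence \<open>zabc\<close> and \<open>w\<close> have the bracket \<open>d\<close>, while \<open>w\<close> and \<open>d\<close> have the bracket \<open>zabc\<close>: the double generator
  written \<open>zabc\<close> is the one with the two remaining indices.
\<close>

lemma product_of_triples:
  assumes product: "zab * bc = T 2 (b * zabc) + T (-2) (za * c) - sc th (T (-1) (z * d) - T (-2) dz)"
    and br: "q_bracket 1 bc w bcw" "q_bracket 1 zabc w d" "q_bracket 1 c w cw"
      "q_bracket 1 w d zabc" "q_bracket 1 w dz wdz"
    and comm: "zab * w = w * zab" "b * w = w * b" "za * w = w * za" "z * w = w * z"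
  shows "zab * bcw = T 2 (b * d) + T (-2) (za * cw)
    - sc th (z * w * d - T 1 (z * zabc) - T (-1) (w * dz) + wdz)"
proof -
  note swap = br(1-3)[THEN q_bracket_swap_back(1)] br(1-3)[THEN q_bracket_swap_back(2)]
    br(4-5)[THEN q_bracket_swap(1)] br(4-5)[THEN q_bracket_swap(2)]
    comm comm[THEN commute_assoc]
  have "lam (T (-1) (zab * bcw)) = (zab * bc) * w - T (-2) (w * (zab * bc))"
    by (simp add: lam_def T_simps algebra_simps swap)
  also have "\<dots> = lam (T (-1) (T 2 (b * d) + T (-2) (za * cw)
    - sc th (z * w * d - T 1 (z * zabc) - T (-1) (w * dz) + wdz)))"
    unfolding product by (simp add: lam_def T_simps algebra_simps swap)
  finally have "T 1 (T (-1) (zab * bcw)) = T 1 (T (-1) (T 2 (b * d) + T (-2) (za * cw)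
    - sc th (z * w * d - T 1 (z * zabc) - T (-1) (w * dz) + wdz)))"
    by (simp only: lam_cancel)
  then show ?thesis
    by (simp only: T_T) (simp add: T_0)
qed

end

section \<open>Relations between the generators of the noncommutative algebra\<close>

lemma q4_powi_generic: "q4 powi 2 \<noteq> q4 powi (-2)"
proof
  assume "q4 powi 2 = q4 powi (-2)"
  then have "q4 ^ 4 = 1"
    using q4_nonzero by (simp add: power_int_def field_simps flip: power_add)
  then have "to_fract ([:0, 1:] ^ 4 :: complex poly poly) = to_fract 1"
    by (simp add: q4_eq_to_fract numeral_eq_Suc del: mult_pCons_left mult_pCons_right)
  then have "degree ([:0, 1:] ^ 4 :: complex poly poly) = 0"
    by (simp only: to_fract_eq_iff degree_1)
  then show False
    by (simp add: degree_power_eq)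
qed

lemma single_0_commutes:
  fixes p :: "'m::monoid_add \<Rightarrow>\<^sub>0 'k::field"
  shows "Poly_Mapping.single 0 c * p = p * Poly_Mapping.single 0 c"
  by (subst (1 2) poly_mapping_eq_sum_single[of p])
    (simp add: sum_distrib_left sum_distrib_right mult_single mult.commute)

interpretation Aqt: q_algebra scale_Aqt q4
proof
  fix c :: kqt and a b :: Aqt
  show "scale_Aqt c a * b = scale_Aqt c (a * b)"
    by (simp add: scale_Aqt_def mult.assoc)
  have "abs_Aqt (Poly_Mapping.single 0 c) * a = a * abs_Aqt (Poly_Mapping.single 0 c)"
    by (induction a rule: Aqt.abs_induct) (simp add: times_Aqt.abs_eq single_0_commutes)
  then show "a * scale_Aqt c b = scale_Aqt c (a * b)"
    by (simp add: scale_Aqt_def mult.assoc[symmetric])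
qed (use q4_nonzero q4_powi_generic in \<open>simp_all only: not_False_eq_True\<close>)

abbreviation "S i \<equiv> gen_Aqt (single_gen i)"
abbreviation "D i \<equiv> gen_Aqt (double_gen i)"
abbreviation "E i \<equiv> gen_Aqt (triple_gen i)"

lemma abs_Aqt_simps:
  "abs_Aqt (a + b) = abs_Aqt a + abs_Aqt b" "abs_Aqt (a - b) = abs_Aqt a - abs_Aqt b"
  "abs_Aqt (- a) = - abs_Aqt a" "abs_Aqt (a * b) = abs_Aqt a * abs_Aqt b"
  "abs_Aqt 1 = 1" "abs_Aqt 0 = 0"
  "abs_Aqt (c \<bullet> a) = scale_Aqt c (abs_Aqt a)" "abs_Aqt (free_gen g) = gen_Aqt g"
  by (simp_all add: plus_Aqt.abs_eq minus_Aqt.abs_eq uminus_Aqt.abs_eq times_Aqt.abs_eq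
      one_Aqt_def zero_Aqt_def scale_Aqt_abs gen_Aqt.abs_eq)

lemma abs_Aqt_rel: "r \<in> rels_qt \<Longrightarrow> abs_Aqt r = 0"
  unfolding zero_Aqt_def Aqt.abs_eq_iff cong_Aqt_def by (simp add: two_sided_ideal.base)

lemma (in q_algebra) scale_inverse_eq_iff: "c \<noteq> 0 \<Longrightarrow> sc (1 / c) a = b \<longleftrightarrow> a = sc c b"
  by auto

lemma abs_Aqt_qcomm_eq_iff:
  "abs_Aqt (qcomm j a b) = c \<longleftrightarrow> Aqt.q_bracket j (abs_Aqt a) (abs_Aqt b) c"
proof -
  have "q4 powi 2 - q4 powi (-2) \<noteq> 0"
    using q4_powi_generic unfolding right_minus_eq .
  from Aqt.scale_inverse_eq_iff[OF this] show ?thesis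
    unfolding qcomm_def abs_Aqt_simps Aqt.T_def Aqt.q_bracket_def Aqt.lam_eq_scale .
qed

lemma single_gen_cong: "i mod 6 = j mod 6 \<Longrightarrow> single_gen i = single_gen j"
  and double_gen_cong: "i mod 6 = j mod 6 \<Longrightarrow> double_gen i = double_gen j"
  by (simp_all add: single_gen_def double_gen_def)

lemma triple_gen_cong: "i mod 3 = j mod 3 \<Longrightarrow> triple_gen i = triple_gen j"
  by (simp add: triple_gen_def)

text \<open>
  The relations are periodic in the index, so they may be used for every index without reducing
  it to the range from 1 to 6.
\<close>

lemma local_rels_qt_subset: "local_rels_qt i \<subseteq> rels_qt"
proof -
  \<comment> \<open>the representative of the index in the range from 1 to 6\<close>
  define j where "j = (i + 5) mod 6 + 1"
  have shift: "single_gen (j + k) = single_gen (i + k)" "double_gen (j + k) = double_gen (i + k)"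
    "triple_gen (j + k) = triple_gen (i + k)" for k
  proof -
    have "(j + k) mod 6 = (i + k) mod 6" "(j + k) mod 3 = (i + k) mod 3"
      unfolding atomize_conj
    proof
      obtain m where "i + 5 = 6 * m + (i + 5) mod 6"
        by (metis mult_div_mod_eq)
      then have m: "i + k + 6 = (j + k) + 6 * m" "i + k + 2 * 3 = (j + k) + (2 * m) * 3"
        by (simp_all add: j_def)
      show "(j + k) mod 6 = (i + k) mod 6"
        using arg_cong[OF m(1), of "\<lambda>n. n mod 6"] by simp
      show "(j + k) mod 3 = (i + k) mod 3"
        using arg_cong[OF m(2), of "\<lambda>n. n mod 3"] by (simp only: mod_mult_self1)
    qed
    then show "single_gen (j + k) = single_gen (i + k)" "double_gen (j + k) = double_gen (i + k)"
      "triple_gen (j + k) = triple_gen (i + k)"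
      by (auto intro: single_gen_cong double_gen_cong triple_gen_cong)
  qed
  have "local_rels_qt j = local_rels_qt i"
    by (simp only: local_rels_qt_def Let_def shift shift[of 0, simplified])
  moreover have "j \<in> {1..6}"
    unfolding j_def by simp
  ultimately show ?thesis
    unfolding rels_qt_def by blast
qed

lemma Aqt_local_rel: "a - b \<in> local_rels_qt i \<Longrightarrow> abs_Aqt a = abs_Aqt b"
  using abs_Aqt_rel[of "a - b"] local_rels_qt_subset[of i] by (auto simp: abs_Aqt_simps)

abbreviation "free_S i \<equiv> free_gen (single_gen i) :: kqt free_alg"
abbreviation "free_D i \<equiv> free_gen (double_gen i) :: kqt free_alg"
abbreviation "free_E i \<equiv> free_gen (triple_gen i) :: kqt free_alg"

lemma local_rels_qt_members:
  "qcomm 1 (free_S i) (free_S (i+1)) - free_D i \<in> local_rels_qt i"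
  "qcomm 1 (free_D i) (free_S i) - free_S (i+1) \<in> local_rels_qt i"
  "qcomm 1 (free_S (i+1)) (free_D i) - free_S i \<in> local_rels_qt i"
  "qcomm 1 (free_D i) (free_S (i+2)) - free_E i \<in> local_rels_qt i"
  "qcomm 1 (free_S (i+5)) (free_D i) - free_E (i+5) \<in> local_rels_qt i"
  "free_D i * free_S (i+3) - free_S (i+3) * free_D i \<in> local_rels_qt i"
  "free_D i * free_S (i+4) - free_S (i+4) * free_D i \<in> local_rels_qt i"
  "qcomm 1 (free_E i) (free_S i) - free_D (i+1) \<in> local_rels_qt i"
  "qcomm 1 (free_S (i+2)) (free_E i) - free_D i \<in> local_rels_qt i"
  "free_E i * free_S (i+1) - free_S (i+1) * free_E i \<in> local_rels_qt i"
  "qcomm 2 (free_D (i+1)) (free_D i) - ((q4 powi (-2) * (q4 ^ 4 + 1)) \<bullet> (free_S i * free_S (i+2))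
     - theta \<bullet> free_S (i+4)) \<in> local_rels_qt i"
  "qcomm 1 (free_D i) (free_D (i+2)) - free_D (i+4) \<in> local_rels_qt i"
  "free_D i * free_D (i+3) - free_D (i+3) * free_D i \<in> local_rels_qt i"
  "qcomm 1 (free_E i) (free_D i) - free_S (i+2) \<in> local_rels_qt i"
  "qcomm 1 (free_D (i+1)) (free_E i) - free_S i \<in> local_rels_qt i"
  "qcomm 0 (free_E i) (free_D (i+2)) - (free_S (i+2) * free_D (i+4) - free_S (i+3) * free_D i)
     \<in> local_rels_qt i"
  unfolding local_rels_qt_def Let_def by (rule insertI1 | rule insertI2)+

lemma scale_Aqt_two_powers:
  "scale_Aqt (q4 powi (-2) * (q4 ^ 4 + 1)) a = Aqt.T 2 a + Aqt.T (-2) a"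
proof -
  have "q4 powi (-2) * (q4 ^ 4 + 1) = q4 powi 2 + q4 powi (-2)"
    using q4_nonzero by (simp add: power_int_def field_simps flip: power_add)
  then show ?thesis
    by (simp add: Aqt.T_def Aqt.scale_left_distrib)
qed

lemma Aqt_local_rels:
  "Aqt.q_bracket 1 (S i) (S (i+1)) (D i)"
  "Aqt.q_bracket 1 (D i) (S i) (S (i+1))"
  "Aqt.q_bracket 1 (S (i+1)) (D i) (S i)"
  "Aqt.q_bracket 1 (D i) (S (i+2)) (E i)"
  "Aqt.q_bracket 1 (S (i+5)) (D i) (E (i+5))"
  "D i * S (i+3) = S (i+3) * D i"
  "D i * S (i+4) = S (i+4) * D i"
  "Aqt.q_bracket 1 (E i) (S i) (D (i+1))"
  "Aqt.q_bracket 1 (S (i+2)) (E i) (D i)"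
  "E i * S (i+1) = S (i+1) * E i"
  "Aqt.q_bracket 2 (D (i+1)) (D i)
     (Aqt.T 2 (S i * S (i+2)) + Aqt.T (-2) (S i * S (i+2)) - scale_Aqt theta (S (i+4)))"
  "Aqt.q_bracket 1 (D i) (D (i+2)) (D (i+4))"
  "D i * D (i+3) = D (i+3) * D i"
  "Aqt.q_bracket 1 (E i) (D i) (S (i+2))"
  "Aqt.q_bracket 1 (D (i+1)) (E i) (S i)"
  "Aqt.q_bracket 0 (E i) (D (i+2)) (S (i+2) * D (i+4) - S (i+3) * D i)"
  by (rule local_rels_qt_members[THEN Aqt_local_rel,
        unfolded abs_Aqt_qcomm_eq_iff abs_Aqt_simps scale_Aqt_two_powers])+

lemma gen_shift:
  "single_gen (i+6) = single_gen i" "single_gen (i+7) = single_gen (i+1)"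
  "triple_gen (i+3) = triple_gen i" "triple_gen (i+4) = triple_gen (i+1)"
  "triple_gen (i+5) = triple_gen (i+2)" "triple_gen (i+6) = triple_gen i"
  by (rule single_gen_cong triple_gen_cong, presburger)+

lemmas index_simps = gen_shift add.assoc numeral_plus_numeral one_plus_numeral numeral_plus_one
  one_add_one add_num_simps

lemma S_commute_far: "k \<in> {2, 3, 4} \<Longrightarrow> S i * S (i+k) = S (i+k) * S i"
proof -
  assume k: "k \<in> {2, 3, 4}"
  \<comment> \<open>the representative of the index in the range from 1 to 6\<close>
  define r where "r n = (n + 5) mod 6 + 1" for n :: nat
  have r: "single_gen (r n) = single_gen n" "r n \<in> {1..6}" for n
  proof -
    show "r n \<in> {1..6}" by (simp add: r_def)
    have "r n mod 6 = (n + 6) mod 6"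
      unfolding r_def by (simp only: mod_add_left_eq) simp
    then show "single_gen (r n) = single_gen n"
      by (intro single_gen_cong) simp
  qed
  have "(int (r i) - int (r (i + k))) mod 6 = (- int k) mod 6"
  proof -
    have "(int (r i) - int (r (i + k))) mod 6 = ((int i + 5) mod 6 - (int i + int k + 5) mod 6) mod 6"
      by (simp add: r_def zmod_int)
    also have "\<dots> = (- int k) mod 6"
      by (simp add: mod_diff_eq)
    finally show ?thesis .
  qed
  also have "\<dots> \<notin> {0, 1, 5}"
    using k by auto
  finally have "free_gen (single_gen (r i)) * free_gen (single_gen (r (i+k)))
      - free_gen (single_gen (r (i+k))) * free_gen (single_gen (r i)) \<in> rels_qt"
    using r(2)[of i] r(2)[of "i+k"] unfolding rels_qt_def by blast
  from abs_Aqt_rel[OF this] show ?thesis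
    by (simp add: abs_Aqt_simps r(1))
qed

lemma S_commute_far':
  "S i * S (i+2) = S (i+2) * S i" "S i * S (i+3) = S (i+3) * S i" "S i * S (i+4) = S (i+4) * S i"
  by (rule S_commute_far, simp)+

lemma S_D_bracket: "Aqt.q_bracket 1 (S i) (D (i+1)) (E i)"
  using Aqt_local_rels(5)[of "i+1"] by (simp only: index_simps)

text \<open>
  The three identities behind the three families of commutative relations. They hold exactly in the
  noncommutative algebra, with the powers of \<open>q\<close> recorded by the operators \<open>T\<close>.
\<close>

lemma D_D_product:
  "D (i+2) * D (i+3) = Aqt.T 2 (S (i+3) * E (i+2)) + Aqt.T (-2) (S (i+2) * S (i+4))
    - scale_Aqt theta (S i)"
proof (rule Aqt.product_of_overlapping_doubles)
  show "Aqt.q_bracket 1 (S (i+2)) (S (i+3)) (D (i+2))"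
    using Aqt_local_rels(1)[of "i+2"] by (simp only: index_simps)
  show "Aqt.q_bracket 1 (S (i+2)) (D (i+3)) (E (i+2))"
    using S_D_bracket[of "i+2"] by (simp only: index_simps)
  show "Aqt.q_bracket 1 (D (i+3)) (S (i+3)) (S (i+4))"
    using Aqt_local_rels(2)[of "i+3"] by (simp only: index_simps)
  show "E (i+2) * S (i+3) = S (i+3) * E (i+2)"
    using Aqt_local_rels(10)[of "i+2"] by (simp only: index_simps)
  show "S (i+4) * S (i+2) = S (i+2) * S (i+4)"
    using S_commute_far'(1)[of "i+2"] by (simp only: index_simps)
  show "Aqt.q_bracket 2 (D (i+3)) (D (i+2)) (Aqt.T 2 (S (i+2) * S (i+4))
      + Aqt.T (-2) (S (i+2) * S (i+4)) - scale_Aqt theta (S i))"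
    using Aqt_local_rels(11)[of "i+2"] by (simp only: index_simps)
qed

lemma E_D_product:
  "E (i+1) * D (i+3) = Aqt.T 2 (S (i+3) * D (i+5)) + Aqt.T (-2) (D (i+1) * S (i+4))
    - scale_Aqt theta (Aqt.T (-1) (S (i+1) * S i) - Aqt.T (-2) (D i))"
proof (rule Aqt.product_of_triple_and_double[OF D_D_product])
  show "Aqt.q_bracket 1 (S (i+1)) (D (i+2)) (E (i+1))"
    using S_D_bracket[of "i+1"] by (simp only: index_simps)
  show "Aqt.q_bracket 1 (S (i+1)) (E (i+2)) (D (i+5))"
    using Aqt_local_rels(9)[of "i+5"] by (simp only: index_simps)
  show "Aqt.q_bracket 1 (S (i+1)) (S (i+2)) (D (i+1))"
    using Aqt_local_rels(1)[of "i+1"] by (simp only: index_simps)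
  show "Aqt.q_bracket 1 (S i) (S (i+1)) (D i)"
    by (rule Aqt_local_rels(1))
  show "D (i+3) * S (i+1) = S (i+1) * D (i+3)"
    using Aqt_local_rels(7)[of "i+3"] by (simp only: index_simps)
  show "S (i+3) * S (i+1) = S (i+1) * S (i+3)"
    using S_commute_far'(1)[of "i+1"] by (simp only: index_simps)
  show "S (i+4) * S (i+1) = S (i+1) * S (i+4)"
    using S_commute_far'(2)[of "i+1"] by (simp only: index_simps)
qed

lemma E_E_product:
  "E (i+1) * E i = Aqt.T 2 (S (i+3) * S i) + Aqt.T (-2) (D (i+1) * D (i+4))
    - scale_Aqt theta (S (i+1) * S (i+5) * S i - Aqt.T 1 (S (i+1) * D (i+5))
      - Aqt.T (-1) (S (i+5) * D i) + E (i+2))"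
proof (rule Aqt.product_of_triples[OF E_D_product])
  show "Aqt.q_bracket 1 (D (i+3)) (S (i+5)) (E i)"
    using Aqt_local_rels(4)[of "i+3"] by (simp only: index_simps)
  show "Aqt.q_bracket 1 (D (i+5)) (S (i+5)) (S i)"
    using Aqt_local_rels(2)[of "i+5"] by (simp only: index_simps)
  show "Aqt.q_bracket 1 (S (i+4)) (S (i+5)) (D (i+4))"
    using Aqt_local_rels(1)[of "i+4"] by (simp only: index_simps)
  show "Aqt.q_bracket 1 (S (i+5)) (S i) (D (i+5))"
    using Aqt_local_rels(1)[of "i+5"] by (simp only: index_simps)
  show "Aqt.q_bracket 1 (S (i+5)) (D i) (E (i+2))"
    using Aqt_local_rels(5)[of i] by (simp only: index_simps)
  show "E (i+1) * S (i+5) = S (i+5) * E (i+1)"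
    using Aqt_local_rels(10)[of "i+4"] by (simp only: index_simps)
  show "S (i+3) * S (i+5) = S (i+5) * S (i+3)"
    using S_commute_far'(1)[of "i+3"] by (simp only: index_simps)
  show "D (i+1) * S (i+5) = S (i+5) * D (i+1)"
    using Aqt_local_rels(7)[of "i+1"] by (simp only: index_simps)
  show "S (i+1) * S (i+5) = S (i+5) * S (i+1)"
    using S_commute_far'(3)[of "i+1"] by (simp only: index_simps)
qed

section \<open>The reduction satisfies the commutative relations\<close>

lemma sum_1_3: "(\<Sum>i=1..3. f i) = f 1 + f 2 + f (3::nat)"
  and sum_1_6: "(\<Sum>i=1..6. f i) = f 1 + f 2 + f 3 + f 4 + f 5 + f (6::nat)"
  by (simp_all add: eval_nat_numeral)

locale qt_specialization = laurent_point emb y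
  for emb :: "complex \<Rightarrow> 'l::field" and y :: 'l +
  assumes basis_qt: "B_is_basis scale_Aqt gen_Aqt"
    and laurent: "b1 \<in> B \<Longrightarrow> b2 \<in> B \<Longrightarrow> b3 \<in> B \<Longrightarrow>
      struct_const scale_Aqt gen_Aqt b1 b2 b3 \<in> range (laurent_eval const_kqt q4 t4)"
begin

sublocale integral_form scale_Aqt gen_Aqt laurent_ring ev
proof unfold_locales
  show "B_is_basis scale_Aqt gen_Aqt"
    by (rule basis_qt)
  show "scale_Aqt c a * b = scale_Aqt c (a * b)" "a * scale_Aqt c b = scale_Aqt c (a * b)" for c a b
    by (rule Aqt.scale_mult_left Aqt.scale_mult_right)+
  show "struct_const scale_Aqt gen_Aqt b1 b2 b3 \<in> laurent_ring" if "b1 \<in> B" "b2 \<in> B" "b3 \<in> B" for b1 b2 b3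
    using laurent[OF that] ev_laurent_eval(1) by auto
qed

lemma L_T: "a \<in> L \<Longrightarrow> Aqt.T k a \<in> L"
  and red_T: "a \<in> L \<Longrightarrow> red (Aqt.T k a) b = red a b"
  by (simp_all add: Aqt.T_def L_scale red_scale laurent_ring_powi ev_gens)

lemmas L_intros = L_1 L_x L_add L_diff L_uminus L_mult L_scale L_T

definition commuting :: "gen \<Rightarrow> gen \<Rightarrow> bool" where
  "commuting g h \<longleftrightarrow> red (gen_Aqt g * gen_Aqt h) = red (gen_Aqt h * gen_Aqt g)"

lemma commuting_sym: "commuting g h \<longleftrightarrow> commuting h g"
  by (auto simp: commuting_def)

text \<open>
  Powers of \<open>q\<close> become 1 and \<open>lam\<close> becomes 0 in the reduction. Integrality of \<open>c\<close> is essential: over the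
  field of rational functions every commutator is a multiple of \<open>lam\<close>.
\<close>

lemma commuting_if_q_bracket:
  assumes "Aqt.q_bracket j (gen_Aqt g) (gen_Aqt h) c" "c \<in> L"
  shows "commuting g h"
proof -
  let ?g = "gen_Aqt g" and ?h = "gen_Aqt h"
  have "Aqt.T j (?g * ?h) - Aqt.T (- j) (?h * ?g) = Aqt.T 2 c - Aqt.T (- 2) c"
    using assms(1) by (simp add: Aqt.q_bracket_def Aqt.lam_def)
  then have "red (Aqt.T j (?g * ?h) - Aqt.T (- j) (?h * ?g)) b = red (Aqt.T 2 c - Aqt.T (- 2) c) b" for b
    by simp
  then show ?thesis
    using assms(2) by (simp add: commuting_def fun_eq_iff red_diff red_T L_T L_mult L_x)
qed

lemma commuting_local:
  "commuting (single_gen i) (single_gen (i+1))"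
  "commuting (double_gen i) (single_gen i)"
  "commuting (single_gen (i+1)) (double_gen i)"
  "commuting (double_gen i) (single_gen (i+2))"
  "commuting (single_gen (i+5)) (double_gen i)"
  "commuting (triple_gen i) (single_gen i)"
  "commuting (single_gen (i+2)) (triple_gen i)"
  "commuting (double_gen (i+1)) (double_gen i)"
  "commuting (double_gen i) (double_gen (i+2))"
  "commuting (triple_gen i) (double_gen i)"
  "commuting (double_gen (i+1)) (triple_gen i)"
  "commuting (triple_gen i) (double_gen (i+2))"
  by (rule commuting_if_q_bracket[OF Aqt_local_rels(1)] commuting_if_q_bracket[OF Aqt_local_rels(2)]
      commuting_if_q_bracket[OF Aqt_local_rels(3)] commuting_if_q_bracket[OF Aqt_local_rels(4)]
      commuting_if_q_bracket[OF Aqt_local_rels(5)] commuting_if_q_bracket[OF Aqt_local_rels(8)]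
      commuting_if_q_bracket[OF Aqt_local_rels(9)] commuting_if_q_bracket[OF Aqt_local_rels(11)]
      commuting_if_q_bracket[OF Aqt_local_rels(12)] commuting_if_q_bracket[OF Aqt_local_rels(14)]
      commuting_if_q_bracket[OF Aqt_local_rels(15)] commuting_if_q_bracket[OF Aqt_local_rels(16)],
      simp add: L_intros theta_laurent_ring)+

lemma commuting_strict:
  "commuting (single_gen i) (single_gen (i+2))"
  "commuting (single_gen i) (single_gen (i+3))"
  "commuting (single_gen i) (single_gen (i+4))"
  "commuting (double_gen i) (single_gen (i+3))"
  "commuting (double_gen i) (single_gen (i+4))"
  "commuting (triple_gen i) (single_gen (i+1))"
  "commuting (double_gen i) (double_gen (i+3))"
  unfolding commuting_def
  by (rule arg_cong[of _ _ red], rule S_commute_far' Aqt_local_rels)+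

lemma commuting_triples:
  "commuting O123 O345" "commuting O234 O123" "commuting O345 O234"
proof -
  have "\<forall>r \<in> triple_rels_qt. abs_Aqt r = 0"
    using abs_Aqt_rel by (auto simp: rels_qt_def)
  note brackets = this[unfolded triple_rels_qt_def Let_def ball_simps abs_Aqt_simps
      right_minus_eq abs_Aqt_qcomm_eq_iff]
  show "commuting O123 O345" "commuting O234 O123" "commuting O345 O234"
    using brackets
    by (auto elim!: commuting_if_q_bracket intro!: L_intros laurent_ring_intros theta_laurent_ring)
qed

text \<open>
  Every pair of distinct generators is, in one of the two orders, the subject of a defining relation.
\<close>

lemma commuting: "commuting g h"
proof -
  note instances = commuting_local[of 1] commuting_local[of 2] commuting_local[of 3]
    commuting_local[of 4] commuting_local[of 5] commuting_local[of 6]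
    commuting_strict[of 1] commuting_strict[of 2] commuting_strict[of 3]
    commuting_strict[of 4] commuting_strict[of 5] commuting_strict[of 6]
  note facts = commuting_triples
    instances[unfolded single_gen_def double_gen_def triple_gen_def, simplified]
  have "commuting g g" by (simp add: commuting_def)
  then show ?thesis
    by (cases g; cases h) (simp_all only: facts facts[THEN iffD1[OF commuting_sym]])
qed

sublocale commutative_reduction scale_Aqt gen_Aqt laurent_ring ev
  using commuting by unfold_locales (simp add: commuting_def)

lemma red_commute: "red (gen_Aqt g * gen_Aqt h) = red (gen_Aqt h * gen_Aqt g)"
  by (rule x_commute)

lemma red_permute3:
  "mset [g, h, k] = mset [g', h', k'] \<Longrightarrow>
    red (gen_Aqt g * gen_Aqt h * gen_Aqt k) = red (gen_Aqt g' * gen_Aqt h' * gen_Aqt k')"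
  using cong_word_permute[of "[g, h, k]" "[g', h', k']"] by (simp add: cong_def mult.assoc)

lemmas red_simps = red_add red_diff red_uminus red_scale red_T red_sum L_intros L_sum
  theta_laurent_ring

lemmas lifts_intros = lifts_diff lifts_add lifts_uminus lifts_scale lifts_sum lifts_gen_mult
  lifts_gen lifts_1

abbreviation "s i \<equiv> poly_gen (single_gen i) :: 'l poly_alg"
abbreviation "d i \<equiv> poly_gen (double_gen i) :: 'l poly_alg"
abbreviation "e i \<equiv> poly_gen (triple_gen i) :: 'l poly_alg"

lemma vanishing_a:
  "s (i+2) * s (i+4) + s (i+3) * e (i+2) - d (i+2) * d (i+3) - ev theta \<bullet> s i \<in> vanishing"
proof (rule vanishing_if_lifts)
  show "lifts (s (i+2) * s (i+4) + s (i+3) * e (i+2) - d (i+2) * d (i+3) - ev theta \<bullet> s i)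
    (S (i+2) * S (i+4) + S (i+3) * E (i+2) - D (i+2) * D (i+3) - scale_Aqt theta (S i))"
    by (intro lifts_intros theta_laurent_ring)
  show "red (S (i+2) * S (i+4) + S (i+3) * E (i+2) - D (i+2) * D (i+3) - scale_Aqt theta (S i)) b = 0"
    for b
    unfolding D_D_product by (simp add: red_simps)
qed

lemma vanishing_b:
  "- s (i+3) * d (i+5) - s (i+4) * d (i+1) + d (i+3) * e (i+1)
    - ev theta \<bullet> (d i - s i * s (i+1)) \<in> vanishing"
proof (rule vanishing_if_lifts)
  show "lifts (- s (i+3) * d (i+5) - s (i+4) * d (i+1) + d (i+3) * e (i+1)
      - ev theta \<bullet> (d i - s i * s (i+1)))
    (- (S (i+3) * D (i+5)) - S (i+4) * D (i+1) + D (i+3) * E (i+1)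
      - scale_Aqt theta (D i - S i * S (i+1)))"
    unfolding mult_minus_left by (intro lifts_intros theta_laurent_ring)
  show "red (- (S (i+3) * D (i+5)) - S (i+4) * D (i+1) + D (i+3) * E (i+1)
      - scale_Aqt theta (D i - S i * S (i+1))) b = 0" for b
  proof -
    have "red (D (i+3) * E (i+1)) b = red (E (i+1) * D (i+3)) b"
      by (simp only: red_commute)
    also have "\<dots> = red (S (i+3) * D (i+5)) b + red (D (i+1) * S (i+4)) b
        - ev theta * (red (S (i+1) * S i) b - red (D i) b)"
      unfolding E_D_product by (simp add: red_simps)
    also have "red (D (i+1) * S (i+4)) = red (S (i+4) * D (i+1))"
      by (rule red_commute)
    also have "red (S (i+1) * S i) = red (S i * S (i+1))"
      by (rule red_commute)
    finally show ?thesis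
      by (simp add: red_simps algebra_simps)
  qed
qed

lemma vanishing_c:
  "- d (i+1) * d (i+4) + e i * e (i+1) - s i * s (i+3)
    - ev theta \<bullet> (- e (i+2) + s (i+1) * d (i+5) + s (i+5) * d i - s i * s (i+1) * s (i+5)) \<in> vanishing"
proof (rule vanishing_if_lifts)
  show "lifts (- d (i+1) * d (i+4) + e i * e (i+1) - s i * s (i+3)
      - ev theta \<bullet> (- e (i+2) + s (i+1) * d (i+5) + s (i+5) * d i - s i * s (i+1) * s (i+5)))
    (- (D (i+1) * D (i+4)) + E i * E (i+1) - S i * S (i+3)
      - scale_Aqt theta (- E (i+2) + S (i+1) * D (i+5) + S (i+5) * D i - S i * (S (i+1) * S (i+5))))"
    unfolding mult_minus_left mult.assoc by (intro lifts_intros theta_laurent_ring)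
  show "red (- (D (i+1) * D (i+4)) + E i * E (i+1) - S i * S (i+3)
      - scale_Aqt theta (- E (i+2) + S (i+1) * D (i+5) + S (i+5) * D i - S i * (S (i+1) * S (i+5)))) b = 0"
    for b
  proof -
    have "red (E i * E (i+1)) b = red (E (i+1) * E i) b"
      by (simp only: red_commute)
    also have "\<dots> = red (S (i+3) * S i) b + red (D (i+1) * D (i+4)) b
        - ev theta * (red (S (i+1) * S (i+5) * S i) b - red (S (i+1) * D (i+5)) b
          - red (S (i+5) * D i) b + red (E (i+2)) b)"
      unfolding E_E_product by (simp add: red_simps)
    also have "red (S (i+3) * S i) = red (S i * S (i+3))"
      by (rule red_commute)
    also have "red (S (i+1) * S (i+5) * S i) = red (S i * (S (i+1) * S (i+5)))"
      using red_permute3[of "single_gen (i+1)" "single_gen (i+5)" "single_gen i"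
          "single_gen i" "single_gen (i+1)" "single_gen (i+5)"]
      by (simp add: mult.assoc)
    finally show ?thesis
      by (simp add: red_simps algebra_simps)
  qed
qed

text \<open>
  The coefficients in the \<open>q\<close>-Casimir relation and their values at \<open>q = 1\<close>. The coefficient of the
  squares of the single generators vanishes there, and the constant term turns into \<open>\<kappa>\<^sup>3\<close>.
\<close>

lemma casimir_coefficients_laurent_ring:
  fixes q t :: kqt
  defines "q \<equiv> q4 ^ 4" and "t \<equiv> t4 ^ 4"
  shows
    "1/3 \<in> laurent_ring" "1/6 * q4 powi (-2) * (q^2 + 2) \<in> laurent_ring"
    "1/6 * q4 powi (-5) * t4 powi (-2) * (2*q + 1) * (q + t) \<in> laurent_ring"
    "1/3 * q4 powi 2 \<in> laurent_ring"
    "1/6 * q4 powi (-6) * t4 powi (-2) * (2*q + 1) * (q + t) \<in> laurent_ring"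
    "1/6 * q4 powi (-6) * t4 powi (-2) * (q - 1) * (q + t) \<in> laurent_ring"
    "q4 powi (-6) * t4 powi (-6) * (t + 1) * (q + t) * (q^2 + t) \<in> laurent_ring"
  unfolding q_def t_def by (intro laurent_ring_intros)+

lemma ev_casimir_coefficients:
  fixes q t :: kqt
  defines "q \<equiv> q4 ^ 4" and "t \<equiv> t4 ^ 4"
  shows "ev (1/3) = 1/3" "ev (1/6 * q4 powi (-2) * (q^2 + 2)) = 1/2"
    "ev (1/6 * q4 powi (-5) * t4 powi (-2) * (2*q + 1) * (q + t)) = ev theta / 2"
    "ev (1/3 * q4 powi 2) = 1/3"
    "ev (1/6 * q4 powi (-6) * t4 powi (-2) * (2*q + 1) * (q + t)) = ev theta / 2"
    "ev (1/6 * q4 powi (-6) * t4 powi (-2) * (q - 1) * (q + t)) = 0"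
    "ev (q4 powi (-6) * t4 powi (-6) * (t + 1) * (q + t) * (q^2 + t)) = ev theta ^ 3"
proof -
  have [simp]: "q \<in> laurent_ring" "ev q = 1" "t \<in> laurent_ring" "ev t = y ^ 4"
    by (simp_all add: q_def t_def ev_simps)
  have k: "y powi (-2) * (1 + y ^ 4) = ev theta"
    using y_nonzero by (simp add: ev_theta power_int_def field_simps flip: power_add)
  have sixth: "1/6 * (3 * a) = a / (2 :: 'l)" for a
    using numeral_nonzero by (simp add: field_simps)
  show "ev (1/3) = 1/3" "ev (1/3 * q4 powi 2) = 1/3"
    by (simp_all only: ev_simps) simp_all
  show "ev (1/6 * q4 powi (-2) * (q^2 + 2)) = 1/2"
    using sixth[of 1] by (simp add: ev_simps)
  have "ev (1/6 * q4 powi (-5) * t4 powi (-2) * (2*q + 1) * (q + t))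
      = 1/6 * (3 * (y powi (-2) * (1 + y ^ 4)))"
    by (simp add: ev_simps)
  then show "ev (1/6 * q4 powi (-5) * t4 powi (-2) * (2*q + 1) * (q + t)) = ev theta / 2"
    unfolding k sixth .
  have "ev (1/6 * q4 powi (-6) * t4 powi (-2) * (2*q + 1) * (q + t))
      = 1/6 * (3 * (y powi (-2) * (1 + y ^ 4)))"
    by (simp add: ev_simps)
  then show "ev (1/6 * q4 powi (-6) * t4 powi (-2) * (2*q + 1) * (q + t)) = ev theta / 2"
    unfolding k sixth .
  show "ev (1/6 * q4 powi (-6) * t4 powi (-2) * (q - 1) * (q + t)) = 0"
    by (simp add: ev_simps)
  have "ev (q4 powi (-6) * t4 powi (-6) * (t + 1) * (q + t) * (q^2 + t))
      = y powi (-6) * (y ^ 4 + 1) * (1 + y ^ 4) * (1 + y ^ 4)"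
    by (simp add: ev_simps)
  also have "\<dots> = (y powi (-2) * (1 + y ^ 4)) ^ 3"
    by (simp add: power_int_def power_mult_distrib power3_eq_cube add.commute flip: power_mult power_add)
  finally show "ev (q4 powi (-6) * t4 powi (-6) * (t + 1) * (q + t) * (q^2 + t)) = ev theta ^ 3"
    unfolding k .
qed

lemma abs_Aqt_sum: "abs_Aqt (sum f I) = (\<Sum>i\<in>I. abs_Aqt (f i))"
  by (induction I rule: infinite_finite_induct) (simp_all add: abs_Aqt_simps)

text \<open>
  The \<open>q\<close>-Casimir element is symmetrized over the orderings of each monomial. After reduction the
  orderings agree and the fractions disappear: the three cyclic orderings of the triple generators cancel the
  factor 1/3, the sum over \<open>u\<close> has period 3 and cancels 1/2, the sum over \<open>v\<close> has period 2 and cancels 1/3.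
\<close>

lemma casimir_relation:
  fixes b
  defines "r \<equiv> \<lambda>n. red n b"
  shows "r (E 1 * E 2 * E 3) - (\<Sum>i=1..3. r (S i * S (i+3) * E (i+2)))
      + ev theta / 2 * (\<Sum>i=1..6. r (S (i+1) * S i * D i))
      - (r (S 1 * S 3 * S 5) + r (S 2 * S 4 * S 6))
      - ev theta / 2 * (\<Sum>i=1..6. r (D i * D i)) + ev theta ^ 3 * r 1 = 0"
proof -
  have "abs_Aqt casimir_qt = 0"
    by (rule abs_Aqt_rel) (simp add: rels_qt_def)
  then have "0 = red (abs_Aqt casimir_qt) b"
    by (simp add: red_def coord_0 ev_0)
  also have "\<dots> = 1/3 * (r (gen_Aqt O123 * gen_Aqt O234 * gen_Aqt O345)
        + r (gen_Aqt O234 * gen_Aqt O345 * gen_Aqt O123) + r (gen_Aqt O345 * gen_Aqt O123 * gen_Aqt O234))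
      - 1/2 * (\<Sum>i=1..6. r (S i * S (i+3) * E (i+2)))
      + ev theta / 2 * (\<Sum>i=1..6. r (S (i+1) * S i * D i))
      - 1/3 * (\<Sum>i=1..6. r (S i * S (i+2) * S (i+4)))
      - ev theta / 2 * (\<Sum>i=1..6. r (D i * D i)) + ev theta ^ 3 * r 1"
    unfolding casimir_qt_def Let_def abs_Aqt_simps abs_Aqt_sum power2_eq_square[of "free_gen g" for g] r_def
    by (simp only: red_simps casimir_coefficients_laurent_ring ev_casimir_coefficients) simp
  finally have casimir: "\<dots> = 0"
    by simp
  have E: "r (gen_Aqt O234 * gen_Aqt O345 * gen_Aqt O123) = r (gen_Aqt O123 * gen_Aqt O234 * gen_Aqt O345)"
    "r (gen_Aqt O345 * gen_Aqt O123 * gen_Aqt O234) = r (gen_Aqt O123 * gen_Aqt O234 * gen_Aqt O345)"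
    by (simp_all add: r_def red_permute3[of O234 O345 O123 O123 O234 O345]
        red_permute3[of O345 O123 O234 O123 O234 O345])
  define u v where "u i = r (S i * S (i+3) * E (i+2))" and "v i = r (S i * S (i+2) * S (i+4))" for i
  have u_shift: "u (i+3) = u i" for i
  proof -
    have "u (i+3) = r (S (i+3) * S i * E (i+2))"
      by (simp only: u_def index_simps)
    then show ?thesis
      using red_commute[of "single_gen (i+3)" "single_gen i"]
        red_permute3[of "single_gen (i+3)" "single_gen i" "triple_gen (i+2)"
          "single_gen i" "single_gen (i+3)" "triple_gen (i+2)"]
      by (simp add: u_def r_def)
  qed
  have v_shift: "v (i+2) = v i" for i
  proof -
    have "v (i+2) = r (S (i+2) * S (i+4) * S i)"
      by (simp only: v_def index_simps)
    then show ?thesis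
      using red_permute3[of "single_gen (i+2)" "single_gen (i+4)" "single_gen i"
          "single_gen i" "single_gen (i+2)" "single_gen (i+4)"]
      by (simp add: v_def r_def)
  qed
  have third: "1/3 * (a + a + a) = a" and half: "1/2 * (a + a) = a" for a :: 'l
    using numeral_nonzero by (simp_all add: field_simps)
  have u: "1/2 * (\<Sum>i=1..6. u i) = (\<Sum>i=1..3. u i)"
  proof -
    have "(\<Sum>i=1..6. u i) = (\<Sum>i=1..3. u i) + (\<Sum>i=1..3. u i)"
      unfolding sum_1_6 sum_1_3 using u_shift[of 1] u_shift[of 2] u_shift[of 3] by simp
    then show ?thesis by (simp only: half)
  qed
  have v: "1/3 * (\<Sum>i=1..6. v i) = v 1 + v 2"
  proof -
    have "v 3 = v 1" "v 4 = v 2" "v 5 = v 1" "v 6 = v 2"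
      using v_shift[of 1] v_shift[of 2] v_shift[of 3] v_shift[of 4]
      by (simp_all only: arith_simps one_plus_numeral)
    then have "(\<Sum>i=1..6. v i) = (v 1 + v 2) + (v 1 + v 2) + (v 1 + v 2)"
      unfolding sum_1_6 by (simp only: ac_simps)
    then show ?thesis by (simp only: third)
  qed
  have E_names: "E 1 = gen_Aqt O123" "E 2 = gen_Aqt O234" "E 3 = gen_Aqt O345"
    by (simp_all add: triple_gen_def)
  have v12: "v 1 = r (S 1 * S 3 * S 5)" "v 2 = r (S 2 * S 4 * S 6)"
    by (simp_all only: v_def arith_simps one_plus_numeral)
  show ?thesis
    using casimir unfolding E third u_def[symmetric] v_def[symmetric] u v v12 E_names
    by (simp add: u_def)
qed

lemma vanishing_d:
  "e 1 * e 2 * e 3 - (\<Sum>i=1..3. s i * s (i+3) * e (i+2))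
    + (ev theta / 2) \<bullet> (\<Sum>i=1..6. s (i+1) * s i * d i)
    - (s 1 * s 3 * s 5 + s 2 * s 4 * s 6)
    - (ev theta / 2) \<bullet> (\<Sum>i=1..6. (d i)^2) + (ev theta ^ 3) \<bullet> 1 \<in> vanishing"
proof (rule vanishing_if_lifts)
  have coeff: "ev theta / 2 = ev (theta / 2)" "ev theta ^ 3 = ev (theta ^ 3)"
    "theta / 2 \<in> laurent_ring" "theta ^ 3 \<in> laurent_ring"
    by (simp_all add: divide_numeral ev_power R_power theta_laurent_ring)
  show "lifts (e 1 * e 2 * e 3 - (\<Sum>i=1..3. s i * s (i+3) * e (i+2))
    + (ev theta / 2) \<bullet> (\<Sum>i=1..6. s (i+1) * s i * d i)
    - (s 1 * s 3 * s 5 + s 2 * s 4 * s 6)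
    - (ev theta / 2) \<bullet> (\<Sum>i=1..6. (d i)^2) + (ev theta ^ 3) \<bullet> 1)
    (E 1 * (E 2 * E 3) - (\<Sum>i=1..3. S i * (S (i+3) * E (i+2)))
    + scale_Aqt (theta / 2) (\<Sum>i=1..6. S (i+1) * (S i * D i))
    - (S 1 * (S 3 * S 5) + S 2 * (S 4 * S 6))
    - scale_Aqt (theta / 2) (\<Sum>i=1..6. D i * D i) + scale_Aqt (theta ^ 3) 1)"
    unfolding coeff(1,2) power2_eq_square mult.assoc by (intro lifts_intros coeff(3,4))
  show "red (E 1 * (E 2 * E 3) - (\<Sum>i=1..3. S i * (S (i+3) * E (i+2)))
    + scale_Aqt (theta / 2) (\<Sum>i=1..6. S (i+1) * (S i * D i))
    - (S 1 * (S 3 * S 5) + S 2 * (S 4 * S 6))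
    - scale_Aqt (theta / 2) (\<Sum>i=1..6. D i * D i) + scale_Aqt (theta ^ 3) 1) b = 0" for b
    using casimir_relation[of b] by (simp only: red_simps coeff mult.assoc)
qed

lemma rels_comm_vanishing: "rels_comm (ev theta) \<subseteq> vanishing"
  unfolding rels_comm_def Let_def
  using vanishing_a vanishing_b vanishing_c vanishing_d by blast

lemma reduced_struct_const_rels_comm:
  fixes proj :: "'l poly_alg \<Rightarrow> 'e::{ring, monoid_mult}"
  assumes basis': "basis_algebra sc' (\<lambda>g. proj (poly_gen g))"
    and proj: "\<And>p r. proj p = proj r \<longleftrightarrow> p - r \<in> two_sided_ideal (rels_comm (y powi 2 + y powi - 2))"
      "\<And>p r. proj (p + r) = proj p + proj r" "\<And>p r. proj (p * r) = proj p * proj r" "proj 1 = 1"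
      "\<And>c p. proj (c \<bullet> p) = sc' c (proj p)"
    and B: "b1 \<in> B" "b2 \<in> B" "b3 \<in> B"
    and C: "struct_const scale_Aqt gen_Aqt b1 b2 b3 = laurent_eval const_kqt q4 t4 C"
  shows "struct_const sc' (\<lambda>g. proj (poly_gen g)) b1 b2 b3 = laurent_eval emb 1 y C"
  using reduced_struct_const[OF basis' proj rels_comm_vanishing[unfolded ev_theta] B] C
  by (simp add: ev_laurent_eval)

end

section \<open>Specialization of the structure constants\<close>

theorem corollary40:
  assumes basis_qt: "B_is_basis scale_Aqt gen_Aqt"
    and integral: "\<And>b1 b2 b3. b1 \<in> B \<Longrightarrow> b2 \<in> B \<Longrightarrow> b3 \<in> B \<Longrightarrow>
      struct_const scale_Aqt gen_Aqt b1 b2 b3 \<in> range (laurent_eval const_kqt q4 t4)"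
    and basis_t: "B_is_basis scale_At gen_At"
    and basis_1: "B_is_basis scale_A1 gen_A1"
    and "b1 \<in> B" and "b2 \<in> B" and "b3 \<in> B"
  shows "\<exists>C :: laurent.
      struct_const scale_Aqt gen_Aqt b1 b2 b3 = laurent_eval const_kqt q4 t4 C \<and>
      struct_const scale_At gen_At b1 b2 b3 = laurent_eval const_kt 1 s4 C \<and>
      struct_const scale_A1 gen_A1 b1 b2 b3 = laurent_eval id 1 1 C"
proof -
  interpret t: qt_specialization const_kt s4
    by unfold_locales (fact basis_qt integral)+
  interpret one: qt_specialization id "1 :: complex"
    by unfold_locales (fact basis_qt integral)+
  obtain C where C: "struct_const scale_Aqt gen_Aqt b1 b2 b3 = laurent_eval const_kqt q4 t4 C"
    using integral[OF \<open>b1 \<in> B\<close> \<open>b2 \<in> B\<close> \<open>b3 \<in> B\<close>] by auto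
  have gens: "gen_At = (\<lambda>g. abs_At (poly_gen g))" "gen_A1 = (\<lambda>g. abs_A1 (poly_gen g))"
    by (auto simp: gen_At.abs_eq gen_A1.abs_eq)
  have "struct_const scale_At gen_At b1 b2 b3 = laurent_eval const_kt 1 s4 C"
    unfolding gens
  proof (rule t.reduced_struct_const_rels_comm[OF _ _ _ _ _ _ \<open>b1 \<in> B\<close> \<open>b2 \<in> B\<close> \<open>b3 \<in> B\<close> C])
    show "basis_algebra scale_At (\<lambda>g. abs_At (poly_gen g))"
      using basis_t unfolding gens by unfold_locales
  qed (simp_all add: At.abs_eq_iff cong_At_def rels_t_def plus_At.abs_eq times_At.abs_eq
      one_At_def scale_At_abs)
  moreover have "struct_const scale_A1 gen_A1 b1 b2 b3 = laurent_eval id 1 1 C"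
    unfolding gens
  proof (rule one.reduced_struct_const_rels_comm[OF _ _ _ _ _ _ \<open>b1 \<in> B\<close> \<open>b2 \<in> B\<close> \<open>b3 \<in> B\<close> C])
    show "basis_algebra scale_A1 (\<lambda>g. abs_A1 (poly_gen g))"
      using basis_1 unfolding gens by unfold_locales
  qed (simp_all add: A1.abs_eq_iff cong_A1_def rels_1_def plus_A1.abs_eq times_A1.abs_eq
      one_A1_def scale_A1_abs)
  ultimately show ?thesis
    using C by blast
qed

end
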